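(* Let $p$ be an odd prime, $\Bbbk$ a field of characteristic $p$, $G=\langle\sigma\rangle$ of order $p$ acting on $V=V_3$ with $\sigma x_1=x_1+x_2$, $\sigma x_2=x_2+x_3$, $\sigma x_3=x_3$ on the dual basis, $A=\Bbbk[x_3,\ x_2^2-2x_1x_3-x_2x_3,\ \prod_{i=0}^{p-1}\sigma^i(x_1)]$, and $1\le n\le p$. For $i=0,\dots,n-1$ define \[M_i=\begin{cases}x_1^{i/2}& i\text{ even},\\ x_1^{(i-1)/2}x_2 & i\text{ odd},\end{cases}\qquad P_i=\begin{cases}x_1^{p-1}x_2 & i=0,\\ \Delta(x_1^{p-i/2}) & i \text{ even},\ i>0,\\ x_1^{p-(i+1)/2} & i\text{ odd}.\end{cases}\] Then $K_n=\ker(\Delta^n:\Bbbk[V]\to\Bbbk[V])$ is a free $A$-module with basis \[S_n=\{M_0,M_1,\dots,M_{n-1},\ \Delta^{p-n}(P_0),\Delta^{p-n}(P_1),\dots,\Delta^{p-n}(P_{n-1})\}.\]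
   Context: $\Delta=\sigma-\iota\in\Bbbk G$ acting on $\Bbbk[V]=\Bbbk[x_1,x_2,x_3]$. *)

theory Defs
  imports "HOL-Computational_Algebra.Polynomial"
begin

text \<open>The polynomial ring k[x1,x2,x3] is modelled as nested univariate polynomials
  ((k[x3])[x2])[x1]: outermost variable x1, middle x2, innermost x3.\<close>

type_synonym 'k mpoly3 = "'k poly poly poly"

definition X1 :: "'k::comm_ring_1 mpoly3" where "X1 = [:0, 1:]"
definition X2 :: "'k::comm_ring_1 mpoly3" where "X2 = [:[:0, 1:]:]"
definition X3 :: "'k::comm_ring_1 mpoly3" where "X3 = [:[:[:0, 1:]:]:]"

definition ev3 :: "'k::comm_ring_1 mpoly3 \<Rightarrow> 'k mpoly3 \<Rightarrow> 'k mpoly3 \<Rightarrow> 'k mpoly3 \<Rightarrow> 'k mpoly3" where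
  "ev3 f a b c =
     poly (map_poly (\<lambda>g. poly (map_poly (\<lambda>h. poly (map_poly (\<lambda>t. [:[:[:t:]:]:]) h) c) g) b) f) a"

definition sigma :: "'k::comm_ring_1 mpoly3 \<Rightarrow> 'k mpoly3" where
  "sigma f = ev3 f (X1 + X2) (X2 + X3) X3"

definition Delta :: "'k::comm_ring_1 mpoly3 \<Rightarrow> 'k mpoly3" where
  "Delta f = sigma f - f"

definition normX1 :: "nat \<Rightarrow> 'k::comm_ring_1 mpoly3" where
  "normX1 p = (\<Prod>i<p. (sigma ^^ i) X1)"

definition algA :: "nat \<Rightarrow> 'k::comm_ring_1 mpoly3 set" where
  "algA p = range (\<lambda>q. ev3 q X3 (X2^2 - 2 * X1 * X3 - X2 * X3) (normX1 p))"

definition Mi :: "nat \<Rightarrow> 'k::comm_ring_1 mpoly3" where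
  "Mi i = (if even i then X1 ^ (i div 2) else X1 ^ ((i - 1) div 2) * X2)"

definition Pi :: "nat \<Rightarrow> nat \<Rightarrow> 'k::comm_ring_1 mpoly3" where
  "Pi p i = (if i = 0 then X1 ^ (p - 1) * X2
             else if even i then Delta (X1 ^ (p - i div 2))
             else X1 ^ (p - (i + 1) div 2))"

definition Sn :: "nat \<Rightarrow> nat \<Rightarrow> nat \<Rightarrow> 'k::comm_ring_1 mpoly3" where
  "Sn p n j = (if j < n then Mi j else (Delta ^^ (p - n)) (Pi p (j - n)))"

definition Kn :: "nat \<Rightarrow> 'k::comm_ring_1 mpoly3 set" where
  "Kn n = {f. (Delta ^^ n) f = 0}"

end

theory Submission
  imports Defs "HOL-Computational_Algebra.Primes"
begin

text \<open>
  After inverting \<open>x\<^sub>3\<close> the ring becomes \<open>C[x\<^sub>2]\<close> with \<open>C = k[x\<^sub>3, 1/x\<^sub>3, d]\<close>, where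
  \<open>d = x\<^sub>2\<^sup>2 - 2x\<^sub>1x\<^sub>3 - x\<^sub>2x\<^sub>3\<close>, and the group acts by the shift \<open>x\<^sub>2 \<mapsto> x\<^sub>2 + x\<^sub>3\<close>. Each
  application of \<open>\<Delta>\<close> lowers the \<open>x\<^sub>2\<close>-degree by exactly one unless that degree is divisible by
  \<open>p\<close>; hence elements of \<open>K\<^sub>n\<close> have degree congruent to one of \<open>0, \<dots>, n - 1\<close> modulo \<open>p\<close>.
  The \<open>2n\<close> elements of \<open>S\<^sub>n\<close> have degrees \<open>0, \<dots>, n - 1\<close> and \<open>p, \<dots>, p + n - 1\<close>, the norm of
  \<open>x\<^sub>1\<close> has degree \<open>2p\<close>, and all their leading coefficients are units of \<open>C\<close>, so cancelling leading
  terms shows that \<open>S\<^sub>n\<close> generates \<open>K\<^sub>n\<close> after inverting \<open>x\<^sub>3\<close>. To descend, reduce modulo \<open>x\<^sub>3\<close>: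
  the lexicographic leading exponents \<open>(a, b)\<close> of \<open>x\<^sub>1\<^sup>a x\<^sub>2\<^sup>b\<close> in the reductions of \<open>S\<^sub>n\<close> are pairwise
  distinct modulo \<open>(p, 2)\<close>, while those of elements of \<open>A\<close> lie in \<open>p\<nat> \<times> 2\<nat>\<close>. So \<open>S\<^sub>n\<close> is independent
  modulo \<open>x\<^sub>3\<close>, which makes its span \<open>x\<^sub>3\<close>-saturated and also yields uniqueness of coefficients.
\<close>

section \<open>Homomorphisms out of polynomial rings\<close>

locale rhom =
  fixes h :: "'a::comm_ring_1 \<Rightarrow> 'b::comm_ring_1"
  assumes add: "h (x + y) = h x + h y"
    and mult: "h (x * y) = h x * h y"
    and one: "h 1 = 1"
begin

lemma zero: "h 0 = 0"
  using add[of 0 0] by simp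

lemma uminus: "h (- x) = - h x"
  using add[of x "- x"] zero by (simp add: eq_neg_iff_add_eq_0 add.commute)

lemma diff: "h (x - y) = h x - h y"
  using add[of x "- y"] by (simp add: uminus)

lemma sum: "h (\<Sum>i\<in>I. f i) = (\<Sum>i\<in>I. h (f i))"
  by (induction I rule: infinite_finite_induct) (simp_all add: zero add)

lemma prod: "h (\<Prod>i\<in>I. f i) = (\<Prod>i\<in>I. h (f i))"
  by (induction I rule: infinite_finite_induct) (simp_all add: one mult)

lemma power: "h (x ^ n) = h x ^ n"
  by (induction n) (simp_all add: one mult)

lemma of_nat: "h (of_nat n) = of_nat n"
  by (induction n) (simp_all add: zero one add)

lemma numeral: "h (numeral n) = numeral n"
  using of_nat[of "numeral n"] by simp

lemmas hom_simps = add mult one zero uminus diff sum prod power of_nat numeral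

end

lemma rhom_comp: "rhom g \<Longrightarrow> rhom h \<Longrightarrow> rhom (\<lambda>x. g (h x))"
  by (simp add: rhom_def)

lemma rhom_const: "rhom (\<lambda>c. [:c:])"
  by unfold_locales (simp_all add: one_pCons)

lemma rhom_pcompose: "rhom (\<lambda>f. pcompose f q)"
  by unfold_locales (simp_all add: pcompose_add pcompose_mult pcompose_1)

lemma (in rhom) poly_map_poly_pCons:
  "poly (map_poly h (pCons c f)) a = h c + a * poly (map_poly h f) a"
  by (simp add: map_poly_pCons zero)

lemma (in rhom) rhom_poly_map_poly: "rhom (\<lambda>f. poly (map_poly h f) a)"
proof
  have add': "poly (map_poly h (f + g)) a = poly (map_poly h f) a + poly (map_poly h g) a"
    for f g
  proof (induction f arbitrary: g)
    case (pCons c f)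
    then show ?case
      by (cases g) (simp add: poly_map_poly_pCons add algebra_simps del: map_poly_pCons)
  qed simp
  then show "poly (map_poly h (f + g)) a = poly (map_poly h f) a + poly (map_poly h g) a" for f g .
  have smult': "poly (map_poly h (smult c g)) a = h c * poly (map_poly h g) a" for c g
    by (induction g) (simp_all add: poly_map_poly_pCons mult algebra_simps)
  show "poly (map_poly h (f * g)) a = poly (map_poly h f) a * poly (map_poly h g) a" for f g
    by (induction f)
      (simp_all add: poly_map_poly_pCons add' smult' zero algebra_simps)
  show "poly (map_poly h 1) a = 1"
    by (simp add: one)
qed

text \<open>Mapping coefficients is evaluation at the variable itself, after \<open>h\<close> has
  been followed by the embedding of constants, so \<open>rhom_poly_map_poly\<close> applies.\<close>

lemma (in rhom) rhom_map_poly: "rhom (map_poly h)"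
proof -
  interpret c: rhom "\<lambda>x. [:h x:]"
    by (rule rhom_comp[OF rhom_const rhom_axioms])
  have "map_poly h f = poly (map_poly (\<lambda>x. [:h x:]) f) [:0, 1:]" for f
    by (induction f) (simp_all add: c.poly_map_poly_pCons map_poly_pCons zero)
  then show ?thesis
    using c.rhom_poly_map_poly[of "[:0, 1:]"] by presburger
qed

lemma rhom_poly_ext:
  assumes "rhom g" "rhom h" "\<And>c. g [:c:] = h [:c:]" "g [:0, 1:] = h [:0, 1:]"
  shows "g f = h f"
proof (induction f)
  case 0
  then show ?case using assms(1,2) by (simp add: rhom.zero)
next
  case (pCons c f)
  have "pCons c f = [:c:] + [:0, 1:] * f" by simp
  then show ?case
    using pCons.IH assms by (simp only: rhom.add rhom.mult)
qed

section \<open>Homomorphisms on the three-variable ring and the evaluation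
  \<open>ev3\<close>\<close>

abbreviation cst :: "'k::comm_ring_1 \<Rightarrow> 'k mpoly3" where
  "cst c \<equiv> [:[:[:c:]:]:]"

lemma rhom_cst: "rhom (cst :: 'k::comm_ring_1 \<Rightarrow> _)"
  by (intro rhom_comp[OF rhom_const] rhom_const)

lemma rhom_mpoly3_ext:
  fixes g h :: "'k::comm_ring_1 mpoly3 \<Rightarrow> 'b::comm_ring_1"
  assumes "rhom g" "rhom h" "\<And>c. g (cst c) = h (cst c)"
    "g X1 = h X1" "g X2 = h X2" "g X3 = h X3"
  shows "g f = h f"
proof (rule rhom_poly_ext[OF assms(1,2)])
  have gh: "rhom (\<lambda>c. g [:c:])" "rhom (\<lambda>c. h [:c:])"
    by (intro rhom_comp[OF _ rhom_const] assms)+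
  have gh': "rhom (\<lambda>c. g [:[:c:]:])" "rhom (\<lambda>c. h [:[:c:]:])"
    by (intro rhom_comp[OF _ rhom_const] gh)+
  have "g [:[:c:]:] = h [:[:c:]:]" for c
    using rhom_poly_ext[OF gh'] assms(3,6) by (simp add: X3_def)
  then show "g [:c:] = h [:c:]" for c
    using rhom_poly_ext[OF gh] assms(5) by (simp add: X2_def)
  show "g [:0, 1:] = h [:0, 1:]"
    using assms(4) by (simp add: X1_def)
qed

lemma rhom_eval1: "rhom (\<lambda>h. poly (map_poly cst h) c)"
  by (rule rhom.rhom_poly_map_poly[OF rhom_cst])

lemma rhom_eval2: "rhom (\<lambda>g. poly (map_poly (\<lambda>h. poly (map_poly cst h) c) g) b)"
  by (rule rhom.rhom_poly_map_poly[OF rhom_eval1])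

lemma rhom_ev3: "rhom (\<lambda>f. ev3 f a b c)"
  unfolding ev3_def by (rule rhom.rhom_poly_map_poly[OF rhom_eval2])

lemma ev3_pCons: "ev3 (pCons g f) a b c = ev3 [:g:] a b c + a * ev3 f a b c"
  unfolding ev3_def
  by (simp only: rhom.poly_map_poly_pCons[OF rhom_eval2]) (simp add: rhom.zero[OF rhom_eval2])

lemma ev3_gens [simp]:
  "ev3 (cst t) a b c = cst t" "ev3 X1 a b c = a" "ev3 X2 a b c = b" "ev3 X3 a b c = c"
proof -
  have [simp]: "map_poly cst h = 0 \<longleftrightarrow> h = 0" for h :: "'a poly"
    by (simp add: map_poly_eq_0_iff)
  show "ev3 (cst t) a b c = cst t" "ev3 X1 a b c = a" "ev3 X2 a b c = b" "ev3 X3 a b c = c"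
    unfolding X1_def X2_def X3_def ev3_def
    by (simp_all add: map_poly_pCons rhom.poly_map_poly_pCons[OF rhom_cst] one_pCons[symmetric])
qed

lemma ev3_const_eq: "ev3 [:g:] a b c = poly (map_poly (\<lambda>h. poly (map_poly cst h) c) g) b"
  unfolding ev3_def by (simp add: rhom.poly_map_poly_pCons[OF rhom_eval2])

lemma ev3_const_const_eq: "ev3 [:[:g:]:] a b c = poly (map_poly cst g) c"
  unfolding ev3_const_eq by (simp add: rhom.poly_map_poly_pCons[OF rhom_eval1])

text \<open>Each of the three nested levels is a Horner recursion, so closure passes outwards from
  the constants. This serves as the induction principle for \<open>algA\<close> and, through
  \<open>ev3_X\<close>, for the whole ring.\<close>

lemma ev3_in_subring:
  assumes "\<And>x y. x \<in> S \<Longrightarrow> y \<in> S \<Longrightarrow> x + y \<in> S"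
    and "\<And>x y. x \<in> S \<Longrightarrow> y \<in> S \<Longrightarrow> x * y \<in> S"
    and "\<And>t. cst t \<in> S" "a \<in> S" "b \<in> S" "c \<in> S"
  shows "ev3 f a b c \<in> S"
proof -
  have zero: "0 \<in> S" using assms(3)[of 0] by simp
  have s1: "ev3 [:[:h:]:] a b c \<in> S" for h
    unfolding ev3_const_const_eq
    by (induction h) (simp_all add: rhom.poly_map_poly_pCons[OF rhom_cst] assms zero)
  have s2: "ev3 [:h:] a b c \<in> S" for h
    unfolding ev3_const_eq using s1 unfolding ev3_const_const_eq
    by (induction h) (simp_all add: rhom.poly_map_poly_pCons[OF rhom_eval1] assms zero)
  show ?thesis
    unfolding ev3_def using s2 unfolding ev3_const_eq
    by (induction f) (simp_all add: rhom.poly_map_poly_pCons[OF rhom_eval2] assms zero)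
qed

lemma rhom_id: "rhom (\<lambda>x. x)"
  by unfold_locales simp_all

lemma ev3_X: "ev3 f X1 X2 X3 = f"
  by (rule rhom_mpoly3_ext[OF rhom_ev3 rhom_id]) simp_all

lemma mpoly3_in_subring:
  assumes "\<And>x y. x \<in> S \<Longrightarrow> y \<in> S \<Longrightarrow> x + y \<in> S"
    and "\<And>x y. x \<in> S \<Longrightarrow> y \<in> S \<Longrightarrow> x * y \<in> S"
    and "\<And>t. cst t \<in> S" "X1 \<in> S" "X2 \<in> S" "X3 \<in> S"
  shows "f \<in> S"
  using ev3_in_subring[of S X1 X2 X3 f] assms by (simp add: ev3_X)

section \<open>Difference operators\<close>

text \<open>Both pictures of \<open>Delta\<close> take this form: with step x3 in the coordinates
  x2, d, x3, and with step x2 after reduction modulo x3.\<close>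

definition pdiff :: "'a::comm_ring_1 \<Rightarrow> 'a poly \<Rightarrow> 'a poly" where
  "pdiff a f = pcompose f [:a, 1:] - f"

lemma degree_pcompose_shift: "degree (pcompose f [:a, 1:]) \<le> degree (f :: 'a::idom poly)"
  by (simp add: degree_pcompose)

text \<open>The top terms of f(x + a) and f(x) cancel, and the binomial expansion supplies the next
  one. Only a degree bound is assumed, so that the induction need not ask whether the top
  coefficient vanishes.\<close>

lemma pdiff_top:
  fixes f :: "'a::idom poly"
  assumes "degree f \<le> Suc m"
  shows "degree (pdiff a f) \<le> m \<and> coeff (pdiff a f) m = of_nat (Suc m) * a * coeff f (Suc m)"
  using assms
proof (induction m arbitrary: f)
  case 0
  then obtain b c where "f = [:b, c:]"
    by (metis degree_eq_zeroE degree_pCons_eq_if le_0_eq pCons_cases pCons_0_0 Suc_le_mono)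
  then show ?case
    by (simp add: pdiff_def pcompose_pCons algebra_simps)
next
  case (Suc m)
  obtain c g where f: "f = pCons c g" by (cases f)
  have g: "degree g \<le> Suc m"
    using Suc.prems f by (cases "g = 0") auto
  \<comment> \<open>With f = c + x g, the shifted polynomial is c + (x + a) g(x + a).\<close>
  have eq: "pdiff a f = pCons 0 (pdiff a g) + smult a (pcompose g [:a, 1:])"
    by (simp add: f pdiff_def pcompose_pCons algebra_simps)
  have lc: "coeff (pcompose g [:a, 1:]) (Suc m) = coeff g (Suc m)"
    using Suc.IH[OF g] coeff_eq_0[of "pdiff a g" "Suc m"]
    by (simp add: pdiff_def)
  have "degree (pCons 0 (pdiff a g)) \<le> Suc m"
    using Suc.IH[OF g] by (simp add: degree_pCons_eq_if)
  moreover have "degree (smult a (pcompose g [:a, 1:])) \<le> Suc m"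
    using degree_pcompose_shift[of g a] g by (meson degree_smult_le le_trans)
  ultimately have "degree (pdiff a f) \<le> Suc m"
    unfolding eq by (rule degree_add_le)
  moreover have "coeff (pdiff a f) (Suc m) = of_nat (Suc (Suc m)) * a * coeff f (Suc (Suc m))"
    using Suc.IH[OF g] lc unfolding eq by (simp add: f algebra_simps)
  ultimately show ?case by blast
qed

lemma pdiff_const: "pdiff a [:c:] = 0"
  by (simp add: pdiff_def)

lemma pdiff_funpow_eq_0:
  fixes f :: "'a::idom poly"
  assumes "degree f < k"
  shows "(pdiff a ^^ k) f = 0"
  using assms
proof (induction k arbitrary: f)
  case (Suc k)
  have z: "(pdiff a ^^ k) 0 = 0" for k
    by (induction k) (simp_all add: pdiff_def)
  show ?case
  proof (cases "degree f")
    case 0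
    then show ?thesis
      using pdiff_const z by (metis degree_eq_zeroE funpow_swap1 funpow.simps(2) o_apply)
  next
    case (Suc m)
    then have "degree (pdiff a f) < k"
      using pdiff_top[of f m a] Suc.prems by simp
    then show ?thesis
      using Suc.IH by (simp add: funpow_swap1)
  qed
qed simp

text \<open>Each application multiplies the leading coefficient by \<open>a\<close> and the current
  degree. The factor \<open>c\<close> is the product of the degrees passed, none of which vanishes
  in the field.\<close>

lemma pdiff_funpow_top:
  fixes f :: "'a::idom poly"
  assumes "a \<noteq> 0" "f \<noteq> 0" "k \<le> degree f" "\<And>i. degree f - k < i \<Longrightarrow> i \<le> degree f \<Longrightarrow> \<not> CHAR('a) dvd i"
  shows "\<exists>c. \<not> CHAR('a) dvd c \<and> degree ((pdiff a ^^ k) f) = degree f - k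
    \<and> lead_coeff ((pdiff a ^^ k) f) = of_nat c * a ^ k * lead_coeff f"
  using assms(3,4)
proof (induction k)
  case 0
  then show ?case by (intro exI[of _ 1]) simp
next
  case (Suc k)
  obtain c where c: "\<not> CHAR('a) dvd c" "degree ((pdiff a ^^ k) f) = degree f - k"
      "lead_coeff ((pdiff a ^^ k) f) = of_nat c * a ^ k * lead_coeff f"
  proof (rule exE[OF Suc.IH])
    show "k \<le> degree f" using Suc.prems(1) by simp
    show "\<not> CHAR('a) dvd i" if "degree f - k < i" "i \<le> degree f" for i
      using that Suc.prems by simp
  qed (use that in blast)
  define m where "m = degree f - Suc k"
  have m: "degree f - k = Suc m" using Suc.prems(1) by (simp add: m_def)
  have "\<not> CHAR('a) dvd Suc m"
    using Suc.prems(2)[of "Suc m"] m by (simp add: m_def)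
  then have nz: "of_nat (Suc m) * of_nat c \<noteq> (0 :: 'a)"
    using c(1) unfolding of_nat_eq_0_iff_char_dvd[symmetric] by (metis mult_eq_0_iff)
  let ?g = "(pdiff a ^^ k) f"
  have top: "degree (pdiff a ?g) \<le> m"
      "coeff (pdiff a ?g) m = of_nat (Suc m) * a * coeff ?g (Suc m)"
    using pdiff_top[of ?g m a] c(2) m by auto
  have co: "coeff (pdiff a ?g) m = of_nat (Suc m * c) * a ^ Suc k * lead_coeff f"
    using top(2) c(2,3) m by (simp add: algebra_simps)
  have "coeff (pdiff a ?g) m \<noteq> 0"
    unfolding co of_nat_mult using nz assms(1,2) by (metis mult_eq_0_iff power_not_zero leading_coeff_0_iff)
  then have "degree (pdiff a ?g) = m"
    using top(1) le_degree by (metis le_antisym)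
  moreover have "\<not> CHAR('a) dvd Suc m * c"
    using nz by (metis of_nat_eq_0_iff_char_dvd of_nat_mult)
  ultimately show ?case
    using co by (intro exI[of _ "Suc m * c"]) (simp add: m_def)
qed

text \<open>Otherwise the \<open>n\<close> degrees passed on the way down all lie strictly above the
  last multiple of the characteristic, and the leading coefficient survives by
  \<open>pdiff_funpow_top\<close>.\<close>

lemma degree_mod_less_of_pdiff_funpow_eq_0:
  fixes f :: "'a::idom poly"
  assumes "prime CHAR('a)" "a \<noteq> 0" "f \<noteq> 0" "(pdiff a ^^ n) f = 0"
  shows "degree f mod CHAR('a) < n"
proof (rule ccontr)
  assume ge: "\<not> degree f mod CHAR('a) < n"
  define p where "p = CHAR('a)"
  have p: "p > 0" using assms(1) by (simp add: p_def prime_gt_0_nat)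
  have n: "n \<le> degree f mod p" "degree f mod p \<le> degree f"
    using ge by (auto simp: p_def)
  have "\<not> p dvd i" if "degree f - n < i" "i \<le> degree f" for i
  proof
    assume "p dvd i"
    then obtain q where q: "i = p * q" by auto
    have d: "degree f = p * (degree f div p) + degree f mod p" by simp
    have "p * (degree f div p) < p * q" using that n d q by linarith
    then have "Suc (degree f div p) \<le> q" by simp
    then have "p * Suc (degree f div p) \<le> p * q" by (rule mult_le_mono2)
    moreover have "degree f mod p < p" using p by simp
    ultimately show False using that(2) q d by simp
  qed
  then show False
    using pdiff_funpow_top[of a f n] assms n by (force simp: p_def of_nat_eq_0_iff_char_dvd)
qed

section \<open>The action of the cyclic group\<close>

lemma rhom_sigma: "rhom sigma"
  unfolding sigma_def by (rule rhom_ev3)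

lemma sigma_gens [simp]:
  "sigma (cst t) = cst t" "sigma X1 = X1 + X2" "sigma X2 = X2 + X3" "sigma X3 = X3"
  by (simp_all add: sigma_def)

lemma rhom_sigma_funpow: "rhom (sigma ^^ i)"
proof (induction i)
  case 0
  then show ?case using rhom_id by (simp add: id_def)
next
  case (Suc i)
  then show ?case using rhom_comp[OF rhom_sigma] by (simp add: comp_def)
qed

lemma sigma_funpow_X2: "(sigma ^^ i) X2 = X2 + of_nat i * X3"
  by (induction i) (simp_all add: rhom.hom_simps[OF rhom_sigma] algebra_simps)

lemma sigma_funpow_X1: "(sigma ^^ i) X1 = X1 + of_nat i * X2 + of_nat (i choose 2) * X3"
proof (induction i)
  case (Suc i)
  have "Suc i choose 2 = i + (i choose 2)"
    by (simp add: numeral_2_eq_2)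
  then show ?case
    using Suc by (simp add: rhom.hom_simps[OF rhom_sigma] algebra_simps)
qed (simp add: binomial_eq_0)

lemma funpow_fixpoint: "f x = x \<Longrightarrow> (f ^^ n) x = x"
  by (induction n) simp_all

text \<open>The p-th power moves x1 by p x2 + binom(p,2) x3 and x2 by p x3. Oddness makes p divide
  binom(p,2).\<close>

lemma sigma_funpow_CHAR:
  fixes f :: "'k::comm_ring_1 mpoly3"
  assumes "prime CHAR('k)" "odd CHAR('k)"
  shows "(sigma ^^ CHAR('k)) f = f"
proof (rule rhom_mpoly3_ext[OF rhom_sigma_funpow rhom_id])
  let ?p = "CHAR('k)"
  have p: "2 < ?p"
    using assms prime_ge_2_nat by (metis even_numeral nat_less_le)
  then have "?p dvd (?p choose 2)"
    using assms(1) by (intro dvd_choose_prime) auto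
  then have z: "of_nat (?p choose 2) = (0 :: 'k mpoly3)"
    by (simp add: of_nat_eq_0_iff_char_dvd)
  have z': "of_nat ?p = (0 :: 'k mpoly3)"
    by (simp add: of_nat_eq_0_iff_char_dvd)
  show "(sigma ^^ ?p) X1 = (X1 :: 'k mpoly3)" "(sigma ^^ ?p) X2 = (X2 :: 'k mpoly3)"
    by (simp_all only: sigma_funpow_X1 sigma_funpow_X2 z z' mult_zero_left add_0_right)
  show "(sigma ^^ ?p) (cst c) = cst c" "(sigma ^^ ?p) X3 = X3" for c :: 'k
    by (simp_all add: funpow_fixpoint)
qed

lemma Delta_add: "Delta (f + g) = Delta f + Delta g"
  by (simp add: Delta_def rhom.add[OF rhom_sigma])

lemma Delta_funpow_add: "(Delta ^^ k) (f + g) = (Delta ^^ k) f + (Delta ^^ k) g"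
  by (induction k) (simp_all add: Delta_add)

lemma Delta_funpow_zero: "(Delta ^^ k) 0 = 0"
  by (induction k) (simp_all add: Delta_def rhom.zero[OF rhom_sigma])

lemma Delta_funpow_sum: "(Delta ^^ k) (\<Sum>i\<in>I. f i) = (\<Sum>i\<in>I. (Delta ^^ k) (f i))"
  by (induction I rule: infinite_finite_induct) (simp_all add: Delta_funpow_zero Delta_funpow_add)

lemma Delta_funpow_invariant_mult:
  assumes "sigma a = a"
  shows "(Delta ^^ k) (a * f) = a * (Delta ^^ k) f"
proof (induction k)
  case (Suc k)
  then show ?case
    by (simp add: Delta_def rhom.mult[OF rhom_sigma] assms right_diff_distrib)
qed simp

text \<open>The binomial theorem for the operator \<open>sigma\<close> = 1 + \<open>Delta\<close>,
  by Pascal's rule.\<close>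

lemma sigma_funpow_binomial:
  "(sigma ^^ m) f = (\<Sum>i\<le>m. of_nat (m choose i) * (Delta ^^ i) f)"
proof (induction m)
  case (Suc m)
  have s: "sigma g = g + Delta g" for g :: "'a mpoly3"
    by (simp add: Delta_def)
  have "(sigma ^^ Suc m) f = (\<Sum>i\<le>m. of_nat (m choose i) * sigma ((Delta ^^ i) f))"
    by (simp add: Suc rhom.hom_simps[OF rhom_sigma])
  also have "\<dots> = (\<Sum>i\<le>m. of_nat (m choose i) * (Delta ^^ i) f)
      + (\<Sum>i\<le>m. of_nat (m choose i) * (Delta ^^ Suc i) f)"
    unfolding s by (simp add: distrib_left sum.distrib)
  also have "(\<Sum>i\<le>m. of_nat (m choose i) * (Delta ^^ i) f)
      = (\<Sum>i\<le>Suc m. of_nat (m choose i) * (Delta ^^ i) f)"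
    by (simp add: binomial_eq_0)
  also have "\<dots> = f + (\<Sum>i\<le>m. of_nat (m choose Suc i) * (Delta ^^ Suc i) f)"
    by (subst sum.atMost_Suc_shift) simp
  also have "f + (\<Sum>i\<le>m. of_nat (m choose Suc i) * (Delta ^^ Suc i) f)
        + (\<Sum>i\<le>m. of_nat (m choose i) * (Delta ^^ Suc i) f)
      = f + (\<Sum>i\<le>m. of_nat (Suc m choose Suc i) * (Delta ^^ Suc i) f)"
    by (simp add: sum.distrib distrib_right add.commute)
  also have "\<dots> = (\<Sum>i\<le>Suc m. of_nat (Suc m choose i) * (Delta ^^ i) f)"
    by (subst sum.atMost_Suc_shift) simp
  finally show ?case .
qed simp

text \<open>In the binomial expansion of the p-th power of \<open>sigma\<close>, which is the
  identity, p divides every middle coefficient; only the two end terms remain.\<close>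

lemma Delta_funpow_CHAR:
  fixes f :: "'k::comm_ring_1 mpoly3"
  assumes "prime CHAR('k)" "odd CHAR('k)"
  shows "(Delta ^^ CHAR('k)) f = 0"
proof -
  let ?p = "CHAR('k)"
  have p: "?p > 0" using assms(1) by (simp add: prime_gt_0_nat)
  have "f = (\<Sum>i\<le>?p. of_nat (?p choose i) * (Delta ^^ i) f)"
    using sigma_funpow_CHAR[OF assms, of f] sigma_funpow_binomial[of "?p" f] by metis
  also have "\<dots> = (\<Sum>i\<in>{0, ?p}. of_nat (?p choose i) * (Delta ^^ i) f)"
  proof (rule sum.mono_neutral_right)
    show "\<forall>i\<in>{..?p} - {0, ?p}. of_nat (?p choose i) * (Delta ^^ i) f = 0"
    proof
      fix i assume "i \<in> {..?p} - {0, ?p}"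
      then have "?p dvd (?p choose i)"
        using assms(1) by (intro dvd_choose_prime) auto
      then have "of_nat (?p choose i) = (0 :: 'k mpoly3)"
        by (simp add: of_nat_eq_0_iff_char_dvd)
      then show "of_nat (?p choose i) * (Delta ^^ i) f = 0" by simp
    qed
  qed auto
  also have "\<dots> = f + (Delta ^^ ?p) f"
    using p by simp
  finally show ?thesis by simp
qed

section \<open>The algebra A and its invariance\<close>

definition Dd :: "'k::comm_ring_1 mpoly3" where
  "Dd = X2^2 - 2 * X1 * X3 - X2 * X3"

lemma algA_Dd: "algA p = range (\<lambda>q. ev3 q X3 Dd (normX1 p))"
  by (simp add: algA_def Dd_def)

lemma sigma_Dd: "sigma Dd = Dd"
  by (simp add: Dd_def rhom.hom_simps[OF rhom_sigma] power2_eq_square algebra_simps)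

text \<open>\<open>sigma\<close> permutes the factors cyclically: the last one returns to
  x1.\<close>

lemma sigma_normX1:
  assumes "prime CHAR('k)" "odd CHAR('k)"
  shows "sigma (normX1 CHAR('k)) = (normX1 CHAR('k) :: 'k::comm_ring_1 mpoly3)"
proof -
  let ?p = "CHAR('k)"
  obtain q where q: "?p = Suc q"
    using assms(1) by (metis not0_implies_Suc not_prime_0)
  have "sigma (normX1 ?p) = (\<Prod>i<?p. (sigma ^^ Suc i) (X1 :: 'k mpoly3))"
    by (simp add: normX1_def rhom.prod[OF rhom_sigma])
  also have "\<dots> = (\<Prod>i<q. (sigma ^^ Suc i) X1) * X1"
    using sigma_funpow_CHAR[OF assms, of X1] unfolding q prod.lessThan_Suc by simp
  also have "\<dots> = normX1 ?p"
    unfolding normX1_def q prod.lessThan_Suc_shift by (simp add: mult.commute)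
  finally show ?thesis .
qed

lemma algA_closed:
  shows algA_add: "a \<in> algA p \<Longrightarrow> b \<in> algA p \<Longrightarrow> a + b \<in> algA p"
    and algA_mult: "a \<in> algA p \<Longrightarrow> b \<in> algA p \<Longrightarrow> a * b \<in> algA p"
    and algA_cst: "cst t \<in> algA p"
    and algA_X3: "X3 \<in> algA p"
    and algA_Dd_mem: "Dd \<in> algA p"
    and algA_normX1: "normX1 p \<in> algA p"
proof -
  let ?e = "\<lambda>q. ev3 q X3 Dd (normX1 p)"
  show "a + b \<in> algA p" if ab: "a \<in> algA p" "b \<in> algA p"
  proof -
    obtain q r where "a = ?e q" "b = ?e r"
      using ab unfolding algA_Dd by blast
    then have "a + b = ?e (q + r)"
      by (simp only: rhom.add[OF rhom_ev3])
    then show ?thesis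
      unfolding algA_Dd by blast
  qed
  show "a * b \<in> algA p" if ab: "a \<in> algA p" "b \<in> algA p"
  proof -
    obtain q r where "a = ?e q" "b = ?e r"
      using ab unfolding algA_Dd by blast
    then have "a * b = ?e (q * r)"
      by (simp only: rhom.mult[OF rhom_ev3])
    then show ?thesis
      unfolding algA_Dd by blast
  qed
  show "cst t \<in> algA p"
    unfolding algA_Dd by (rule range_eqI[of _ _ "cst t"]) simp
  \<comment> \<open>The variables \<open>X1\<close>, \<open>X2\<close>, \<open>X3\<close> of the
    parametrising polynomial stand for x3, d and the norm, in this order.\<close>
  show "X3 \<in> algA p"
    unfolding algA_Dd by (rule range_eqI[of _ _ X1]) simp
  show "Dd \<in> algA p"
    unfolding algA_Dd by (rule range_eqI[of _ _ X2]) simp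
  show "normX1 p \<in> algA p"
    unfolding algA_Dd by (rule range_eqI[of _ _ X3]) simp
qed

lemma algA_power: "a \<in> algA p \<Longrightarrow> a ^ k \<in> algA p"
proof (induction k)
  case 0
  show ?case using algA_cst[of 1 p] by (simp add: one_pCons)
qed (simp add: algA_mult)

lemma algA_zero: "0 \<in> algA p"
  using algA_cst[of 0 p] by simp

lemma algA_diff:
  fixes a :: "'a::comm_ring_1 mpoly3"
  assumes "a \<in> algA p" "b \<in> algA p"
  shows "a - b \<in> algA p"
proof -
  have "a + cst (- 1) * b \<in> algA p"
    by (intro algA_closed assms)
  moreover have "cst (- 1) = (- 1 :: 'a mpoly3)" by (simp add: one_pCons)
  ultimately show ?thesis by (simp only: mult_minus1 add_uminus_conv_diff)
qed

lemma sigma_algA: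
  fixes a :: "'k::comm_ring_1 mpoly3"
  assumes "prime CHAR('k)" "odd CHAR('k)" "a \<in> algA CHAR('k)"
  shows "sigma a = a"
proof -
  obtain q where "a = ev3 q X3 Dd (normX1 CHAR('k))"
    using assms(3) by (auto simp: algA_Dd)
  moreover have "ev3 q X3 Dd (normX1 CHAR('k)) \<in> {a. sigma a = a}"
    by (rule ev3_in_subring)
      (simp_all add: rhom.hom_simps[OF rhom_sigma] sigma_Dd sigma_normX1 assms(1,2))
  ultimately show ?thesis by simp
qed

section \<open>Coordinates after inverting \<open>x\<^sub>3\<close>\<close>

text \<open>Here \<^typ>\<open>'k mpoly3\<close> is reused for \<open>(k[x\<^sub>3][d])[x\<^sub>2]\<close>, with \<^term>\<open>X1\<close> in the role of \<open>x\<^sub>2\<close>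
  and \<^term>\<open>X2\<close> in the role of \<open>d\<close>.\<close>

definition psi :: "'k::comm_ring_1 mpoly3 \<Rightarrow> 'k mpoly3" where
  "psi g = ev3 g X2 Dd X3"

lemma rhom_psi: "rhom psi"
  unfolding psi_def by (rule rhom_ev3)

lemma psi_gens [simp]: "psi (cst t) = cst t" "psi X1 = X2" "psi X2 = Dd" "psi X3 = X3"
  by (simp_all add: psi_def)

text \<open>\<open>sigma\<close> fixes d and x3 and shifts x2 by x3, so in these coordinates
  \<open>Delta\<close> is a difference operator in one variable. The step
  \<open>[:[:0, 1:]:]\<close> is x3 as an element of k[x3][d].\<close>

lemma psi_pdiff:
  fixes g :: "'k::comm_ring_1 mpoly3"
  shows "psi (pdiff [:[:0, 1:]:] g) = Delta (psi g)"
proof -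
  have "psi (pcompose g [:[:[:0, 1:]:], 1:]) = sigma (psi g)"
  proof (rule rhom_mpoly3_ext[of _ _ g])
    show "rhom (\<lambda>g. psi (pcompose g [:[:[:0, 1:]:], 1:]))" "rhom (\<lambda>g. sigma (psi g))"
      by (intro rhom_comp[OF rhom_psi] rhom_comp[OF rhom_sigma] rhom_psi rhom_pcompose)+
    have e1: "pcompose X1 [:[:[:0, 1:]:], 1:] = (X1 + X3 :: 'k mpoly3)"
      by (simp add: X1_def X3_def pcompose_pCons)
    show "psi (pcompose X1 [:[:[:0, 1:]:], 1:]) = sigma (psi (X1 :: 'k mpoly3))"
      unfolding e1 by (simp add: rhom.add[OF rhom_psi])
    have e2: "pcompose X2 [:[:[:0, 1:]:], 1:] = (X2 :: 'k mpoly3)"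
      by (simp add: X2_def)
    show "psi (pcompose X2 [:[:[:0, 1:]:], 1:]) = sigma (psi (X2 :: 'k mpoly3))"
      unfolding e2 by (simp add: sigma_Dd)
    have e3: "pcompose X3 [:[:[:0, 1:]:], 1:] = (X3 :: 'k mpoly3)"
      by (simp add: X3_def)
    show "psi (pcompose X3 [:[:[:0, 1:]:], 1:]) = sigma (psi (X3 :: 'k mpoly3))"
      unfolding e3 by simp
  qed simp
  then show ?thesis
    by (simp add: pdiff_def Delta_def rhom.diff[OF rhom_psi])
qed

lemma psi_pdiff_funpow: "psi ((pdiff [:[:0, 1:]:] ^^ k) g) = (Delta ^^ k) (psi g)"
  by (induction k) (simp_all add: psi_pdiff)

lemma psi_pCons: "psi (pCons h g) = psi [:h:] + X2 * psi g"
  unfolding psi_def by (rule ev3_pCons)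

lemma psi_const_pCons: "psi [:pCons r h:] = psi [:[:r:]:] + Dd * psi [:h:]"
  unfolding psi_def ev3_const_const_eq unfolding ev3_const_eq
  by (rule rhom.poly_map_poly_pCons[OF rhom_eval1])

lemma psi_const_const: "psi [:[:r:]:] = [:[:r:]:]"
proof (rule rhom_poly_ext[of _ _ r])
  show "rhom (\<lambda>r. psi [:[:r:]:])" "rhom (\<lambda>r. [:[:r:]:])"
    by (intro rhom_comp[OF rhom_psi] rhom_comp[OF rhom_const] rhom_const)+
  show "psi [:[:[:0, 1:]:]:] = [:[:[:0, 1:]:]:]"
    using psi_gens(4) by (simp add: X3_def)
qed simp

text \<open>d is linear in x1 with coefficient -2 x3, so x1^J can only come from the d^J
  term.\<close>

lemma psi_const_top:
  assumes "degree h \<le> J"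
  shows "degree (psi [:h:]) \<le> J \<and> coeff (psi [:h:]) J = [:[:0, - 2:] ^ J * coeff h J:]"
  using assms
proof (induction h arbitrary: J)
  case 0
  then show ?case by (simp add: rhom.zero[OF rhom_psi])
next
  case (pCons r h)
  have Dd: "Dd = [:[:0, [:0, - 1:], 1:], [:[:0, - 2:]:]:]"
    by (simp add: Dd_def X1_def X2_def X3_def power2_eq_square numeral_poly)
  show ?case
  proof (cases J)
    case 0
    then have "h = 0" using pCons.prems by (simp split: if_splits)
    then show ?thesis
      using 0 by (simp add: psi_const_const)
  next
    case (Suc J')
    then have "degree h \<le> J'"
      using pCons.prems by (simp split: if_splits)
    note IH = pCons.IH[OF this]
    have "degree (Dd * psi [:h:]) \<le> 1 + J'"
      using degree_mult_le[of Dd "psi [:h:]"] IH by (simp add: Dd split: if_splits)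
    then have "degree (psi [:pCons r h:]) \<le> J"
      unfolding psi_const_pCons[of r h] psi_const_const Suc by (intro degree_add_le) simp_all
    moreover have "coeff (psi [:h:]) J = 0"
      using IH Suc by (intro coeff_eq_0) simp
    then have "coeff (Dd * psi [:h:]) J = [:[:0, - 2:]:] * coeff (psi [:h:]) J'"
      by (simp add: Dd Suc)
    then have "coeff (psi [:pCons r h:]) J = [:[:0, - 2:] ^ J * coeff (pCons r h) J:]"
      unfolding psi_const_pCons[of r h] psi_const_const using IH Suc by simp
    ultimately show ?thesis by blast
  qed
qed

text \<open>\<open>J\<close> bounds the d-degree of every coefficient. Powers of x2 do not involve
  x1, so the coefficients of d^J are collected into one polynomial in x2.\<close>

lemma psi_top:
  assumes "\<And>i. degree (coeff g i) \<le> J"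
  shows "coeff (psi g) J = [:[:0, - 2:] ^ J:] * map_poly (\<lambda>h. coeff h J) g"
  using assms
proof (induction g)
  case 0
  then show ?case by (simp add: rhom.zero[OF rhom_psi])
next
  case (pCons h g)
  have h: "degree h \<le> J" and g: "degree (coeff g i) \<le> J" for i
    using pCons.prems[of 0] pCons.prems[of "Suc i"] by simp_all
  have "coeff (X2 * f) J = [:0, 1:] * coeff f J" for f :: "'a mpoly3"
    by (simp add: X2_def)
  then show ?case
    using psi_const_top[OF h] pCons.IH[OF g]
    by (simp add: psi_pCons[of h g] map_poly_pCons)
qed

text \<open>Algebraic independence of x2, d and x3: with \<open>J\<close> the exact d-degree of
  \<open>g\<close>, the coefficient of x1^J in the image is a nonzero multiple of a nonzero
  polynomial in x2.\<close>

lemma psi_eq_0_iff: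
  fixes g :: "'k::idom mpoly3"
  assumes "(2 :: 'k) \<noteq> 0"
  shows "psi g = 0 \<longleftrightarrow> g = 0"
proof
  show "g = 0" if "psi g = 0"
  proof (rule ccontr)
    assume g: "g \<noteq> 0"
    define J where "J = Max ((\<lambda>i. degree (coeff g i)) ` {..degree g})"
    have le: "degree (coeff g i) \<le> J" for i
    proof (cases "i \<le> degree g")
      case True
      then show ?thesis unfolding J_def by (intro Max_ge) auto
    qed (simp add: coeff_eq_0)
    have "J \<in> (\<lambda>i. degree (coeff g i)) ` {..degree g}"
      unfolding J_def by (intro Max_in) auto
    then obtain i where i: "J = degree (coeff g i)" by auto
    obtain i where "coeff (coeff g i) J \<noteq> 0"
    proof (cases "J = 0")
      case True
      then show ?thesis
        using that[of "degree g"] le[of "degree g"] g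
        by (metis le_zero_eq leading_coeff_0_iff)
    next
      case False
      then show ?thesis using that[of i] i by (metis degree_0 leading_coeff_0_iff)
    qed
    then have "map_poly (\<lambda>h. coeff h J) g \<noteq> 0"
      by (metis coeff_0 coeff_map_poly)
    moreover have "[:[:0, - 2:] ^ J:] \<noteq> (0 :: 'k poly poly)"
      using assms by simp
    ultimately have "coeff (psi g) J \<noteq> 0"
      unfolding psi_top[OF le] by (metis mult_eq_0_iff)
    with that show False by simp
  qed
qed (simp add: rhom.zero[OF rhom_psi])

text \<open>The elements u x3^r, which become units once x3 is inverted. No localisation is
  constructed: a statement over it is expressed by multiplying with such an element.\<close>

definition xunit :: "'k::field poly poly \<Rightarrow> bool" where
  "xunit v \<longleftrightarrow> (\<exists>u r. u \<noteq> 0 \<and> v = [:monom u r:])"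

lemma xunit_monom: "u \<noteq> 0 \<Longrightarrow> xunit [:monom u r:]"
  unfolding xunit_def by blast

lemma xunit_mult: "xunit v \<Longrightarrow> xunit w \<Longrightarrow> xunit (v * w)"
  unfolding xunit_def[of v] xunit_def[of w]
  by (elim exE conjE) (simp add: mult_monom xunit_monom)

lemma xunit_one: "xunit 1"
  using xunit_monom[of 1 0] by (simp add: one_pCons monom_0)

lemma xunit_power: "xunit v \<Longrightarrow> xunit (v ^ k)"
  by (induction k) (simp_all add: xunit_one xunit_mult)

lemma xunit_nonzero: "xunit v \<Longrightarrow> v \<noteq> 0"
  by (auto simp: xunit_def)

lemma X3_power: "(X3 :: 'a::comm_ring_1 mpoly3) ^ r = [:[:monom 1 r:]:]"
proof (induction r)
  case (Suc r)
  have X3: "(X3 :: 'a mpoly3) = [:[:monom 1 1:]:]"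
    by (simp add: X3_def monom_altdef)
  show ?case
    unfolding power_Suc Suc unfolding X3 by (simp add: mult_monom)
qed (simp add: one_pCons)

lemma xunit_cst_X3:
  assumes "xunit v"
  obtains u r where "u \<noteq> 0" "[:v:] = cst u * X3 ^ r"
  using assms by (auto simp: xunit_def X3_power smult_monom)

lemma psi_xunit: "xunit v \<Longrightarrow> psi [:v:] = [:v:]"
  by (auto simp: xunit_def psi_const_const)

lemma sigma_xunit: "xunit v \<Longrightarrow> sigma [:v:] = [:v:]"
  by (erule xunit_cst_X3) (simp only: rhom.mult[OF rhom_sigma] rhom.power[OF rhom_sigma] sigma_gens)

lemma algA_xunit: "xunit v \<Longrightarrow> [:v:] \<in> algA p"
  by (erule xunit_cst_X3) (simp only: algA_mult algA_cst algA_power algA_X3)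

text \<open>\<open>rep s m\<close>: over \<open>k[x\<^sub>3, 1/x\<^sub>3, d]\<close>, the element \<open>s\<close> is a polynomial in \<open>x\<^sub>2\<close>
  of degree \<open>m\<close> whose leading coefficient is a unit.\<close>

definition rep :: "'k::field mpoly3 \<Rightarrow> nat \<Rightarrow> bool" where
  "rep s m \<longleftrightarrow> (\<exists>v g. xunit v \<and> [:v:] * s = psi g \<and> degree g = m \<and> xunit (lead_coeff g))"

lemma rep_mult:
  assumes "rep s m" "rep t l"
  shows "rep (s * t) (m + l)"
proof -
  obtain v g where g: "xunit v" "[:v:] * s = psi g" "degree g = m" "xunit (lead_coeff g)"
    using assms(1) unfolding rep_def by blast
  obtain w h where h: "xunit w" "[:w:] * t = psi h" "degree h = l" "xunit (lead_coeff h)"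
    using assms(2) unfolding rep_def by blast
  have "[:v * w:] * (s * t) = psi (g * h)"
    using g(2) h(2) by (simp add: rhom.mult[OF rhom_psi] flip: g(2) h(2)) (simp add: mult.commute)
  moreover have "degree (g * h) = m + l"
    using g h xunit_nonzero by (metis degree_mult_eq leading_coeff_0_iff)
  ultimately show ?thesis
    unfolding rep_def using xunit_mult[OF g(1) h(1)] xunit_mult[OF g(4) h(4)]
    by (metis lead_coeff_mult)
qed

lemma rep_one: "rep 1 0"
  unfolding rep_def
  by (rule exI[of _ 1], rule exI[of _ 1]) (simp add: xunit_one rhom.one[OF rhom_psi] one_pCons[symmetric])

lemma rep_power: "rep s m \<Longrightarrow> rep (s ^ k) (k * m)"
  by (induction k) (simp_all add: rep_one rep_mult)

lemma rep_prod: "(\<And>i. rep (s i) m) \<Longrightarrow> rep (\<Prod>i<k. s i) (k * m)"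
  by (induction k) (simp_all add: rep_one rep_mult add.commute mult.commute)

lemma rep_X2: "rep X2 1"
proof -
  have "[:1:] * X2 = psi (X1 :: 'a mpoly3)" by simp
  moreover have "degree (X1 :: 'a mpoly3) = 1" "lead_coeff (X1 :: 'a mpoly3) = 1"
    by (simp_all add: X1_def)
  ultimately show ?thesis
    unfolding rep_def using xunit_one by metis
qed

text \<open>The equation defining d, solved for x1; it shows that 2 x3 is the only denominator
  required.\<close>

lemma psi_twice_X1_X3: "psi (X1 ^ 2 - X1 * X3 - X2) = 2 * X1 * X3"
  by (simp add: rhom.hom_simps[OF rhom_psi] Dd_def)

lemma twice_X3: "2 * X3 = [:[:monom 2 1:]:]"
  by (simp add: X3_def monom_altdef numeral_poly)

lemma rep_X1:
  assumes "(2 :: 'k::field) \<noteq> 0"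
  shows "rep (X1 :: 'k mpoly3) 2"
proof -
  have "[:[:monom 2 1:]:] * X1 = psi (X1 ^ 2 - X1 * X3 - X2 :: 'k mpoly3)"
    unfolding psi_twice_X1_X3 twice_X3[symmetric] by (simp add: mult_ac)
  moreover have "X1 ^ 2 - X1 * X3 - X2 = ([:[:0, - 1:], [:[:0, - 1:]:], 1:] :: 'k mpoly3)"
    by (simp add: X1_def X2_def X3_def power2_eq_square)
  then have "degree (X1 ^ 2 - X1 * X3 - X2 :: 'k mpoly3) = 2"
     "lead_coeff (X1 ^ 2 - X1 * X3 - X2 :: 'k mpoly3) = 1"
    by simp_all
  ultimately show ?thesis
    unfolding rep_def using xunit_one xunit_monom[OF assms] by metis
qed

lemma rep_sigma:
  assumes "rep s m"
  shows "rep (sigma s) m"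
proof -
  obtain v g where g: "xunit v" "[:v:] * s = psi g" "degree g = m" "xunit (lead_coeff g)"
    using assms unfolding rep_def by blast
  let ?g = "pcompose g [:[:[:0, 1:]:], 1:]"
  have "[:v:] * sigma s = sigma ([:v:] * s)"
    using sigma_xunit[OF g(1)] by (simp only: rhom.mult[OF rhom_sigma])
  \<comment> \<open>The shifted polynomial is written as difference plus original so that
    \<open>psi_pdiff\<close> applies.\<close>
  also have "\<dots> = psi (pdiff [:[:0, 1:]:] g + g)"
    unfolding g(2) rhom.add[OF rhom_psi] psi_pdiff by (simp add: Delta_def)
  finally have "[:v:] * sigma s = psi ?g"
    by (simp add: pdiff_def)
  moreover have "degree ?g = m" "lead_coeff ?g = lead_coeff g"
    using g(3) lead_coeff_comp[of "[:[:[:0, 1:]:], 1:]" g] by (simp_all add: degree_pcompose)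
  ultimately show ?thesis
    unfolding rep_def using g(1,4) by metis
qed

lemma rep_normX1:
  assumes "(2 :: 'k::field) \<noteq> 0"
  shows "rep (normX1 p :: 'k mpoly3) (2 * p)"
proof -
  have "rep ((sigma ^^ i) (X1 :: 'k mpoly3)) 2" for i
    by (induction i) (simp_all add: rep_X1 assms rep_sigma)
  from rep_prod[OF this, where k=p] show ?thesis
    by (simp add: normX1_def mult.commute)
qed

text \<open>The new leading coefficient is the old one times a nonzero scalar and x3^k, hence still
  a unit.\<close>

lemma rep_Delta_funpow:
  fixes s :: "'k::field mpoly3"
  assumes "rep s m" "k \<le> m" "\<And>i. m - k < i \<Longrightarrow> i \<le> m \<Longrightarrow> \<not> CHAR('k) dvd i"
  shows "rep ((Delta ^^ k) s) (m - k)"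
proof -
  obtain v g where g: "xunit v" "[:v:] * s = psi g" "degree g = m" "xunit (lead_coeff g)"
    using assms(1) unfolding rep_def by blast
  let ?a = "[:[:0, 1:]:] :: 'k poly poly"
  have "?a \<noteq> 0" "g \<noteq> 0"
    using xunit_nonzero[OF g(4)] by auto
  from pdiff_funpow_top[OF this, of k] obtain c where c: "\<not> CHAR('k) dvd c"
      "degree ((pdiff ?a ^^ k) g) = m - k"
      "lead_coeff ((pdiff ?a ^^ k) g) = of_nat c * ?a ^ k * lead_coeff g"
    using assms(2,3) g(3) by auto
  have "(of_nat c :: 'k poly poly) = [:monom (of_nat c) 0:]"
    by (simp add: of_nat_poly monom_0)
  moreover have "(of_nat c :: 'k) \<noteq> 0"
    using c(1) by (simp add: of_nat_eq_0_iff_char_dvd)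
  ultimately have "xunit (of_nat c :: 'k poly poly)"
    using xunit_monom by metis
  moreover have "?a = [:monom 1 1:]"
    by (simp add: monom_altdef)
  then have "xunit ?a"
    using xunit_monom[of "1 :: 'k" 1] by simp
  ultimately have "xunit (lead_coeff ((pdiff ?a ^^ k) g))"
    unfolding c(3) by (intro xunit_mult xunit_power g(4))
  moreover have "[:v:] * (Delta ^^ k) s = psi ((pdiff ?a ^^ k) g)"
    unfolding psi_pdiff_funpow g(2)[symmetric]
    by (rule Delta_funpow_invariant_mult[OF sigma_xunit[OF g(1)], symmetric])
  ultimately show ?thesis
    unfolding rep_def using g(1) c(2) by metis
qed

lemma rep_Delta_funpow_eq_0:
  assumes "rep s m" "m < k"
  shows "(Delta ^^ k) s = 0"
proof -
  obtain v g where g: "xunit v" "[:v:] * s = psi g" "degree g = m"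
    using assms(1) unfolding rep_def by blast
  have "[:v:] * (Delta ^^ k) s = psi ((pdiff [:[:0, 1:]:] ^^ k) g)"
    unfolding psi_pdiff_funpow g(2)[symmetric]
    by (rule Delta_funpow_invariant_mult[OF sigma_xunit[OF g(1)], symmetric])
  also have "\<dots> = 0"
    using pdiff_funpow_eq_0[of g k] assms(2) g(3) by (simp add: rhom.zero[OF rhom_psi])
  finally show ?thesis
    using xunit_nonzero[OF g(1)] by (metis mult_eq_0_iff pCons_eq_0_iff)
qed

section \<open>Degrees in x2 of the M_i and of the iterated differences of the P_i\<close>

lemma rep_Mi:
  assumes "(2 :: 'k::field) \<noteq> 0"
  shows "rep (Mi i :: 'k mpoly3) i"
proof (cases "even i")
  case True
  then show ?thesis
    using rep_power[OF rep_X1[OF assms], of "i div 2"] by (simp add: Mi_def)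
next
  case False
  then show ?thesis
    using rep_mult[OF rep_power[OF rep_X1[OF assms], of "(i - 1) div 2"] rep_X2]
    by (simp add: Mi_def)
qed

text \<open>P_i has x2-degree 2p - 1 - i; for even i > 0 one application of \<open>Delta\<close> to
  a power of x1 of degree 2p - i is already included. All degrees to which \<open>Delta\<close> is
  applied lie strictly between p and 2p, so none is divisible by p.\<close>

lemma rep_Delta_funpow_Pi:
  fixes p n i :: nat
  assumes "prime p" "odd p" "CHAR('k::field) = p" "n \<le> p" "i < n"
  shows "rep ((Delta ^^ (p - n)) (Pi p i) :: 'k mpoly3) (p + n - 1 - i)"
proof -
  have "2 < p" using assms(1,2) prime_ge_2_nat[of p] by (cases "p = 2") auto
  then have two: "(2 :: 'k) \<noteq> 0"
    using assms(3) of_nat_eq_0_iff_char_dvd[of 2, where 'a='k] by (auto dest: dvd_imp_le)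
  have nd: "\<not> CHAR('k) dvd j" if "p < j" "j < 2 * p" for j
  proof
    assume "CHAR('k) dvd j"
    then obtain q where "j = p * q" using assms(3) by auto
    then have "p * 1 < p * q" "p * q < p * 2" using that by simp_all
    then show False unfolding nat_mult_less_cancel_disj by simp
  qed
  have X1p: "rep (X1 ^ a :: 'k mpoly3) (2 * a)" for a
    using rep_power[OF rep_X1[OF two]] by (simp add: mult.commute)
  have "rep (Pi p i :: 'k mpoly3) (2 * p - 1 - i)"
  proof -
    consider "i = 0" | "odd i" | "i > 0" "even i" by blast
    then show ?thesis
    proof cases
      case 1
      have "2 * (p - 1) + 1 = 2 * p - 1" using \<open>2 < p\<close> by simp
      then show ?thesis
        using 1 rep_mult[OF X1p[of "p - 1"] rep_X2] by (simp add: Pi_def)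
    next
      case 2
      then have "2 * (p - (i + 1) div 2) = 2 * p - 1 - i"
        using assms(4,5) by (auto elim!: oddE)
      moreover have "(Pi p i :: 'k mpoly3) = X1 ^ (p - (i + 1) div 2)"
        using 2 odd_pos[of i] by (simp add: Pi_def)
      ultimately show ?thesis
        using X1p[of "p - (i + 1) div 2"] by simp
    next
      case 3
      then have eq: "2 * (p - i div 2) = 2 * p - i"
        using assms(4,5) by (auto elim!: evenE)
      have "rep ((Delta ^^ 1) (X1 ^ (p - i div 2)) :: 'k mpoly3) (2 * (p - i div 2) - 1)"
      proof (rule rep_Delta_funpow[OF X1p])
        show "1 \<le> 2 * (p - i div 2)"
          unfolding eq using assms(4,5) by simp
        show "\<not> CHAR('k) dvd j"
          if "2 * (p - i div 2) - 1 < j" "j \<le> 2 * (p - i div 2)" for j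
          using that unfolding eq using 3 assms(4,5) by (intro nd) auto
      qed
      then show ?thesis
        using 3 unfolding eq by (simp add: Pi_def)
    qed
  qed
  then have "rep ((Delta ^^ (p - n)) (Pi p i) :: 'k mpoly3) (2 * p - 1 - i - (p - n))"
    by (rule rep_Delta_funpow) (use assms(4,5) nd in auto)
  moreover have "2 * p - 1 - i - (p - n) = p + n - 1 - i"
    using assms(4,5) by auto
  ultimately show ?thesis by simp
qed

text \<open>Surjectivity of \<open>psi\<close> after inverting x3. The elements with this property
  form a subring containing the generators, and only x1 requires a denominator.\<close>

lemma ex_xunit_mult_eq_psi:
  fixes f :: "'k::field mpoly3"
  assumes "(2 :: 'k) \<noteq> 0"
  shows "\<exists>v g. xunit v \<and> [:v:] * f = psi g"
proof -
  let ?S = "{f :: 'k mpoly3. \<exists>v g. xunit v \<and> [:v:] * f = psi g}"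
  have "f \<in> ?S"
  proof (rule mpoly3_in_subring)
    fix x y :: "'k mpoly3"
    assume "x \<in> ?S" "y \<in> ?S"
    then obtain v g w h where g: "xunit v" "[:v:] * x = psi g" and h: "xunit w" "[:w:] * y = psi h"
      by blast
    have "[:v * w:] * (x + y) = [:w:] * ([:v:] * x) + [:v:] * ([:w:] * y)"
      by (simp add: smult_add_right mult.commute)
    also have "\<dots> = psi ([:w:] * g + [:v:] * h)"
      using g h by (simp only: rhom.add[OF rhom_psi] rhom.mult[OF rhom_psi] psi_xunit)
    finally show "x + y \<in> ?S"
      using xunit_mult[OF g(1) h(1)] by blast
    have "[:v * w:] * (x * y) = ([:v:] * x) * ([:w:] * y)"
      by (simp add: mult.commute)
    also have "\<dots> = psi (g * h)"
      using g h by (simp only: rhom.mult[OF rhom_psi])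
    finally show "x * y \<in> ?S"
      using xunit_mult[OF g(1) h(1)] by blast
  next
    have one: "[:1:] * x = (x :: 'k mpoly3)" for x by simp
    have psi: "psi g \<in> ?S" for g
      using one[of "psi g"] xunit_one by blast
    show "cst t \<in> ?S" "X2 \<in> ?S" "X3 \<in> ?S" for t
      using psi[of "cst t"] psi[of X1] psi[of X3] unfolding psi_gens by this+
    show "X1 \<in> ?S"
      using rep_X1[OF assms] unfolding rep_def by blast
  qed
  then show ?thesis by blast
qed

section \<open>Generation after inverting \<open>x\<^sub>3\<close>\<close>

text \<open>The A-span of S_n, to be identified with \<open>Kn n\<close>.\<close>

definition Ln :: "nat \<Rightarrow> nat \<Rightarrow> 'k::comm_ring_1 mpoly3 set" where
  "Ln p n = {\<Sum>j<2*n. a j * Sn p n j |a. \<forall>j<2*n. a j \<in> algA p}"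

lemma Ln_add:
  assumes "x \<in> Ln p n" "y \<in> Ln p n"
  shows "x + y \<in> Ln p n"
proof -
  obtain a b where "\<forall>j<2*n. a j \<in> algA p" "\<forall>j<2*n. b j \<in> algA p"
      "x = (\<Sum>j<2*n. a j * Sn p n j)" "y = (\<Sum>j<2*n. b j * Sn p n j)"
    using assms unfolding Ln_def by blast
  then have "x + y = (\<Sum>j<2*n. (a j + b j) * Sn p n j)" "\<forall>j<2*n. a j + b j \<in> algA p"
    by (simp_all add: sum.distrib distrib_right algA_add)
  then show ?thesis unfolding Ln_def by (intro CollectI exI[of _ "\<lambda>j. a j + b j"] conjI)
qed

lemma Ln_mult:
  assumes "c \<in> algA p" "x \<in> Ln p n"
  shows "c * x \<in> Ln p n"
proof -
  obtain a where "\<forall>j<2*n. a j \<in> algA p" "x = (\<Sum>j<2*n. a j * Sn p n j)"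
    using assms unfolding Ln_def by blast
  then have "c * x = (\<Sum>j<2*n. (c * a j) * Sn p n j)" "\<forall>j<2*n. c * a j \<in> algA p"
    by (simp_all add: sum_distrib_left mult.assoc algA_mult assms(1))
  then show ?thesis unfolding Ln_def by (intro CollectI exI[of _ "\<lambda>j. c * a j"] conjI)
qed

lemma zero_in_Ln: "0 \<in> Ln p n"
  unfolding Ln_def by (auto intro!: exI[of _ "\<lambda>_. 0"] simp: algA_zero)

lemma Sn_in_Ln:
  assumes "j < 2 * n"
  shows "Sn p n j \<in> Ln p n"
proof -
  have "Sn p n j = (\<Sum>i<2*n. (if i = j then 1 else 0) * Sn p n i)"
    using assms by (simp add: if_distrib if_distribR sum.delta cong: if_cong)
  moreover have "1 \<in> algA p"
    using algA_power[OF algA_X3, of 0 p] by simp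
  ultimately show ?thesis
    unfolding Ln_def by (auto intro!: exI[of _ "\<lambda>i. if i = j then 1 else 0"] simp: algA_zero)
qed

lemma psi_const_in_algA: "psi [:c:] \<in> algA p"
proof -
  \<comment> \<open>The coefficient involves only d and x3, so the value x2 of the outer variable,
    which is not in A, may be replaced by 0.\<close>
  have "psi [:c:] = ev3 [:c:] 0 Dd X3"
    unfolding psi_def ev3_const_eq ..
  then show ?thesis
    using ev3_in_subring[of "algA p" 0 Dd X3 "[:c:]"] algA_closed algA_zero by metis
qed

lemma pdiff_const_mult: "pdiff a ([:c:] * g) = [:c:] * pdiff a g"
  by (simp add: pdiff_def pcompose_smult smult_diff_right)

lemma pdiff_diff: "pdiff a (f - g) = pdiff a f - pdiff a g"
  by (simp add: pdiff_def pcompose_diff)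

lemma pdiff_funpow_const_mult: "(pdiff a ^^ k) ([:c:] * g) = [:c:] * (pdiff a ^^ k) g"
  by (induction k) (simp_all only: funpow.simps o_apply id_apply pdiff_const_mult)

lemma pdiff_funpow_diff: "(pdiff a ^^ k) (f - g) = (pdiff a ^^ k) f - (pdiff a ^^ k) g"
  by (induction k) (simp_all add: pdiff_diff)

section \<open>Cancelling leading terms in K_n\<close>

context
  fixes p n :: nat and ty :: "'k::field itself"
  assumes p: "prime p" "odd p" "CHAR('k) = p" and n: "n \<le> p"
begin

lemma two_nonzero: "(2 :: 'k) \<noteq> 0"
proof -
  have "2 < p" using p(1,2) prime_ge_2_nat[of p] by (cases "p = 2") auto
  then show ?thesis
    using p(3) of_nat_eq_0_iff_char_dvd[of 2, where 'a='k] by (auto dest: dvd_imp_le)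
qed

text \<open>M_j has x2-degree j < n, and on the other elements the n-th power completes
  \<open>Delta\<close> to its p-th power, which is zero.\<close>

lemma Sn_in_Kn:
  assumes "j < 2 * n"
  shows "(Delta ^^ n) (Sn p n j :: 'k mpoly3) = 0"
proof (cases "j < n")
  case True
  then show ?thesis
    using rep_Delta_funpow_eq_0[OF rep_Mi[OF two_nonzero]] by (simp add: Sn_def)
next
  case False
  have "(Delta ^^ n) ((Delta ^^ (p - n)) f) = (Delta ^^ p) f" for f :: "'k mpoly3"
    using n by (metis funpow_add le_add_diff_inverse o_apply)
  then show ?thesis
    using False Delta_funpow_CHAR[where 'k='k] p by (simp add: Sn_def)
qed

lemma rep_Sn:
  assumes "j < 2 * n"
  shows "rep (Sn p n j :: 'k mpoly3) (if j < n then j else p + 2 * n - 1 - j)"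
proof (cases "j < n")
  case True
  then show ?thesis
    using rep_Mi[OF two_nonzero] by (simp add: Sn_def)
next
  case False
  \<comment> \<open>The second half of S_n is indexed by j = n + i, so its degrees descend from p +
    n - 1 to p.\<close>
  have "p + n - 1 - (j - n) = p + 2 * n - 1 - j" using False by simp
  then show ?thesis
    using rep_Delta_funpow_Pi[OF p n, of "j - n"] False assms by (simp add: Sn_def)
qed

text \<open>The degrees i and p + i, for i < n, cover every residue modulo 2p that is below n modulo
  p; powers of the norm supply the multiples of 2p.\<close>

lemma ex_Sn_degree:
  assumes "m mod p < n"
  obtains j q where "j < 2 * n" "m = (if j < n then j else p + 2 * n - 1 - j) + q * (2 * p)"
proof -
  define i where "i = m mod p"
  have m: "i + (m div p) * p = m" and i: "i < n" using assms by (simp_all add: i_def)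
  show ?thesis
  proof (cases "even (m div p)")
    case True
    then obtain q where "m div p = 2 * q" by blast
    then have "m = i + q * (2 * p)" using m by (simp add: algebra_simps)
    then show ?thesis
      using that[of i q] i by simp
  next
    case False
    then obtain q where "m div p = 2 * q + 1" by (elim oddE)
    then have "m = i + p + q * (2 * p)" using m by (simp add: algebra_simps)
    \<comment> \<open>The degrees of the second half descend, so degree p + i sits at index 2n - 1 -
      i.\<close>
    then show ?thesis
      using that[of "2 * n - 1 - i" q] i by simp
  qed
qed

text \<open>Induction on the x2-degree: the leading term is cancelled against an element of S_n
  times a power of the norm, and the remainder stays in the kernel.\<close>

lemma xunit_mult_psi_in_Ln:
  fixes g :: "'k mpoly3"
  assumes "(pdiff [:[:0, 1:]:] ^^ n) g = 0"
  shows "\<exists>v. xunit v \<and> [:v:] * psi g \<in> Ln p n"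
  using assms
proof (induction "degree g" arbitrary: g rule: less_induct)
  case less
  let ?D = "pdiff [:[:0, 1:]:] :: 'k mpoly3 \<Rightarrow> _"
  show ?case
  proof (cases "g = 0")
    case True
    then show ?thesis
      using xunit_one zero_in_Ln by (metis mult_zero_right rhom.zero[OF rhom_psi])
  next
    case False
    define m where "m = degree g"
    have "m mod CHAR('k poly poly) < n"
      unfolding m_def
      by (rule degree_mod_less_of_pdiff_funpow_eq_0[OF _ _ False less.prems]) (use p in simp_all)
    then obtain j q where j: "j < 2 * n"
        and m: "m = (if j < n then j else p + 2 * n - 1 - j) + q * (2 * p)"
      using ex_Sn_degree p(3) by auto
    let ?N = "normX1 p ^ q :: 'k mpoly3"
    have "rep (Sn p n j * ?N) m"
      unfolding m by (intro rep_mult rep_Sn[OF j] rep_power rep_normX1 two_nonzero)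
    then obtain v h where h: "xunit v" "[:v:] * (Sn p n j * ?N) = psi h" "degree h = m"
        "xunit (lead_coeff h)"
      unfolding rep_def by blast
    let ?w = "lead_coeff h" and ?c = "lead_coeff g"
    \<comment> \<open>Cross-multiplication avoids division: only the unit \<open>?w\<close> lands in
      front of \<open>g\<close>, while \<open>?c\<close>, a polynomial in d and x3, goes into a
      coefficient from A.\<close>
    define g' where "g' = [:?w:] * g - [:?c:] * h"
    have inv: "sigma ([:v:] * ?N) = [:v:] * ?N"
      using sigma_xunit[OF h(1)] sigma_normX1[where 'k='k, unfolded p(3), OF p(1,2)]
      by (simp only: rhom.mult[OF rhom_sigma] rhom.power[OF rhom_sigma])
    \<comment> \<open>The factor in front of \<open>Sn p n j\<close> is invariant, so
      \<open>Delta\<close> passes through it; injectivity of \<open>psi\<close> then carries the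
      vanishing over to \<open>h\<close>.\<close>
    have "psi ((?D ^^ n) h) = (Delta ^^ n) (([:v:] * ?N) * Sn p n j)"
      unfolding psi_pdiff_funpow h(2)[symmetric] by (simp add: mult.commute)
    also have "\<dots> = 0"
      unfolding Delta_funpow_invariant_mult[OF inv] Sn_in_Kn[OF j] by simp
    finally have "(?D ^^ n) h = 0"
      by (simp add: psi_eq_0_iff[OF two_nonzero])
    then have g'0: "(?D ^^ n) g' = 0"
      unfolding g'_def pdiff_funpow_diff pdiff_funpow_const_mult less.prems by simp
    have "\<exists>v. xunit v \<and> [:v:] * psi g' \<in> Ln p n"
    proof (cases "g' = 0")
      case True
      then show ?thesis
        using xunit_one zero_in_Ln by (metis mult_zero_right rhom.zero[OF rhom_psi])
    next
      case g': False
      have "degree g' \<le> m"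
        unfolding g'_def using h(3)
        by (intro degree_diff_le) (auto simp: m_def)
      moreover have "coeff g' m = 0"
        using h(3) by (simp add: g'_def m_def)
      ultimately have "degree g' < degree g"
        using g' by (metis m_def le_neq_implies_less leading_coeff_0_iff)
      then show ?thesis
        using less.hyps g'0 by blast
    qed
    then obtain u where u: "xunit u" "[:u:] * psi g' \<in> Ln p n" by blast
    have "[:u * ?w:] * psi g = [:u:] * psi ([:?w:] * g)"
      unfolding rhom.mult[OF rhom_psi] psi_xunit[OF h(4)] by (simp add: mult.commute)
    also have "[:?w:] * g = g' + [:?c:] * h"
      by (simp add: g'_def)
    also have "[:u:] * psi (g' + [:?c:] * h)
        = [:u:] * psi g' + ([:u:] * psi [:?c:] * [:v:] * ?N) * Sn p n j"
      unfolding rhom.add[OF rhom_psi] rhom.mult[OF rhom_psi] h(2)[symmetric]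
      by (simp add: algebra_simps)
    also have "\<dots> \<in> Ln p n"
      by (intro Ln_add u(2) Ln_mult Sn_in_Ln j algA_mult algA_xunit u(1) h(1) psi_const_in_algA
          algA_power algA_normX1)
    finally show ?thesis
      using xunit_mult[OF u(1) h(4)] by blast
  qed
qed

lemma xunit_mult_in_Ln:
  fixes f :: "'k mpoly3"
  assumes "f \<in> Kn n"
  shows "\<exists>v. xunit v \<and> [:v:] * f \<in> Ln p n"
proof -
  obtain v g where g: "xunit v" "[:v:] * f = psi g"
    using ex_xunit_mult_eq_psi[OF two_nonzero] by blast
  have "psi ((pdiff [:[:0, 1:]:] ^^ n) g) = 0"
    using assms
    by (simp only: psi_pdiff_funpow g(2)[symmetric] Delta_funpow_invariant_mult[OF sigma_xunit[OF g(1)]]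
        Kn_def mem_Collect_eq mult_zero_right)
  then have "(pdiff [:[:0, 1:]:] ^^ n) g = 0"
    by (simp add: psi_eq_0_iff[OF two_nonzero])
  then obtain u where u: "xunit u" "[:u:] * psi g \<in> Ln p n"
    using xunit_mult_psi_in_Ln by blast
  have "[:u:] * psi g = [:u * v:] * f"
    by (simp add: mult.commute flip: g(2))
  then show ?thesis
    using u xunit_mult[OF u(1) g(1)] by metis
qed

end

section \<open>Independence modulo \<open>x\<^sub>3\<close>\<close>

text \<open>Reduction modulo x3, with values in (k[x2])[x1].\<close>

definition rho :: "'k::comm_ring_1 mpoly3 \<Rightarrow> 'k poly poly" where
  "rho = map_poly (map_poly (\<lambda>h. poly h 0))"

lemma rhom_rho: "rhom rho"
  unfolding rho_def
  by (intro rhom.rhom_map_poly) (unfold_locales, simp_all)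

lemma rho_gens [simp]:
  "rho (cst t) = [:[:t:]:]" "rho X1 = [:0, 1:]" "rho X2 = [:[:0, 1:]:]" "rho X3 = 0"
  by (simp_all add: rho_def X1_def X2_def X3_def map_poly_pCons)

text \<open>Modulo x3 the group fixes x2 and shifts x1 by x2.\<close>

lemma rho_sigma:
  fixes f :: "'k::comm_ring_1 mpoly3"
  shows "rho (sigma f) = pcompose (rho f) [:[:0, 1:], 1:]"
proof (rule rhom_mpoly3_ext[of _ _ f])
  show "rhom (\<lambda>f. rho (sigma f))" "rhom (\<lambda>f. pcompose (rho f) [:[:0, 1:], 1:])"
    by (intro rhom_comp[OF rhom_rho rhom_sigma] rhom_comp[OF rhom_pcompose rhom_rho])+
qed (simp_all add: rhom.add[OF rhom_rho] pcompose_pCons)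

lemma rho_Delta_funpow: "rho ((Delta ^^ k) f) = (pdiff [:0, 1:] ^^ k) (rho f)"
  by (induction k) (simp_all add: Delta_def pdiff_def rhom.diff[OF rhom_rho] rho_sigma)

text \<open>The leading monomial is x1^a x2^b in the lexicographic order with x1 first.\<close>

definition lexdeg :: "'k::idom poly poly \<Rightarrow> nat \<Rightarrow> nat \<Rightarrow> bool" where
  "lexdeg f a b \<longleftrightarrow> f \<noteq> 0 \<and> degree f = a \<and> degree (coeff f a) = b"

lemma lexdeg_mult: "lexdeg f a b \<Longrightarrow> lexdeg g c d \<Longrightarrow> lexdeg (f * g) (a + c) (b + d)"
  unfolding lexdeg_def by (auto simp: degree_mult_eq coeff_mult_degree_sum)

lemma lexdeg_one: "lexdeg 1 0 0"
  by (simp add: lexdeg_def)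

lemma lexdeg_power: "lexdeg f a b \<Longrightarrow> lexdeg (f ^ k) (k * a) (k * b)"
  by (induction k) (simp_all add: lexdeg_one lexdeg_mult)

lemma lexdeg_rho_monomial: "lexdeg (rho (X1 ^ a * X2 ^ b :: 'k::idom mpoly3)) a b"
proof -
  have "lexdeg ([:0, 1:] :: 'k poly poly) 1 0" "lexdeg ([:[:0, 1:]:] :: 'k poly poly) 0 1"
    by (simp_all add: lexdeg_def)
  from lexdeg_mult[OF this[THEN lexdeg_power]] show ?thesis
    by (simp add: rhom.hom_simps[OF rhom_rho])
qed

text \<open>Modulo x3, each \<open>Delta\<close> trades one x1 for one x2 in the leading monomial
  and multiplies its coefficient by the current exponent of x1.\<close>

lemma lexdeg_rho_Delta_funpow:
  fixes f :: "'k::idom mpoly3"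
  assumes "lexdeg (rho f) a b" "k \<le> a" "\<And>i. a - k < i \<Longrightarrow> i \<le> a \<Longrightarrow> \<not> CHAR('k) dvd i"
  shows "lexdeg (rho ((Delta ^^ k) f)) (a - k) (b + k)"
proof -
  let ?x = "[:0, 1:] :: 'k poly"
  have nz: "?x \<noteq> 0" "rho f \<noteq> 0" using assms(1) by (auto simp: lexdeg_def)
  obtain c where c: "\<not> CHAR('k) dvd c"
      "degree ((pdiff ?x ^^ k) (rho f)) = a - k"
      "lead_coeff ((pdiff ?x ^^ k) (rho f)) = of_nat c * ?x ^ k * lead_coeff (rho f)"
    using pdiff_funpow_top[OF nz, of k] assms by (auto simp: lexdeg_def)
  define L where "L = lead_coeff (rho f)"
  have L: "L \<noteq> 0" "degree L = b"
    using nz assms(1) by (auto simp: L_def lexdeg_def)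
  have cnz: "(of_nat c :: 'k poly) \<noteq> 0"
    using c(1) by (simp add: of_nat_eq_0_iff_char_dvd)
  then have "of_nat c * ?x ^ k * L \<noteq> 0" "degree (of_nat c * ?x ^ k * L) = b + k"
    using L by (simp_all add: degree_mult_eq degree_power_eq)
  then show ?thesis
    using c(2,3) unfolding rho_Delta_funpow lexdeg_def L_def by auto
qed

text \<open>The lexicographically largest of the leading monomials, with exponents \<open>m\<close>
  and \<open>e\<close>, occurs in exactly one summand and cannot cancel.\<close>

lemma sum_lexdeg_nonzero:
  assumes "finite J" "J \<noteq> {}" "\<And>j. j \<in> J \<Longrightarrow> lexdeg (f j) (a j) (b j)"
    and "inj_on (\<lambda>j. (a j, b j)) J"
  shows "(\<Sum>j\<in>J. f j) \<noteq> 0"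
proof -
  define m where "m = Max (a ` J)"
  define J' where "J' = {j \<in> J. a j = m}"
  have "m \<in> a ` J" unfolding m_def using assms by simp
  then have J': "J' \<noteq> {}" "finite J'" using assms(1) by (auto simp: J'_def)
  have am: "a j \<le> m" if "j \<in> J" for j
    unfolding m_def using that assms(1) by simp
  define e where "e = Max (b ` J')"
  have "e \<in> b ` J'" unfolding e_def using J' by simp
  then obtain i where i: "i \<in> J" "a i = m" "b i = e" by (auto simp: J'_def)
  have be: "b j \<le> e" if "j \<in> J" "a j = m" for j
    unfolding e_def using that J' by (simp add: J'_def)
  have "coeff (coeff (f j) m) e = 0" if j: "j \<in> J - {i}" for j
  proof (cases "a j = m")
    case True
    then have "b j \<noteq> e"
      using assms(4) i j by (auto simp: inj_on_def)
    then have "b j < e" using be[of j] j True by simp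
    moreover have "degree (coeff (f j) m) = b j"
      using assms(3)[of j] j True by (simp add: lexdeg_def)
    ultimately show ?thesis by (simp add: coeff_eq_0)
  next
    case False
    then have "degree (f j) < m"
      using am[of j] assms(3)[of j] j by (auto simp: lexdeg_def)
    then show ?thesis by (simp add: coeff_eq_0)
  qed
  then have "coeff (coeff (\<Sum>j\<in>J. f j) m) e = coeff (coeff (f i) m) e"
    using assms(1) i(1) by (simp add: coeff_sum sum.remove[of J i])
  also have "\<dots> \<noteq> 0"
    using assms(3)[OF i(1)] i unfolding lexdeg_def by (metis leading_coeff_0_iff)
  finally show ?thesis by auto
qed

text \<open>Modulo x3 the factors are x1 + i x2, so their product is monic of degree p in
  x1.\<close>

lemma lexdeg_rho_normX1: "lexdeg (rho (normX1 p :: 'k::idom mpoly3)) p 0"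
proof -
  have "lexdeg (rho ((sigma ^^ i) (X1 :: 'k mpoly3))) 1 0" for i
  proof -
    have "rho ((sigma ^^ i) (X1 :: 'k mpoly3)) = [:of_nat i * [:0, 1:], 1:]"
    proof -
      have "of_nat i * [:[:0, 1:]:] = [:of_nat i * [:0, 1 :: 'k:]:]"
        by (simp add: of_nat_poly)
      then show ?thesis
        unfolding sigma_funpow_X1
        by (simp only: rhom.add[OF rhom_rho] rhom.mult[OF rhom_rho] rhom.of_nat[OF rhom_rho] rho_gens) simp
    qed
    then show ?thesis by (simp add: lexdeg_def)
  qed
  then have "lexdeg (\<Prod>i<q. rho ((sigma ^^ i) (X1 :: 'k mpoly3))) q 0" for q
  proof (induction q)
    case (Suc q)
    then show ?case
      using lexdeg_mult[OF Suc.IH[OF Suc.prems] Suc.prems[of q]] by simp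
  qed (simp add: lexdeg_one)
  then show ?thesis
    by (simp add: normX1_def rhom.prod[OF rhom_rho])
qed

text \<open>Here \<open>u\<close> is a polynomial in the slot of \<open>N\<close> whose coefficients
  are polynomials in d. Since d reduces to x2^2, its coefficients undergo the substitution of x2^2
  for the variable.\<close>

lemma rho_ev3_const:
  fixes u :: "'k::idom poly poly"
  shows "rho (ev3 [:u:] 0 N Dd) = pcompose (map_poly (\<lambda>h. pcompose h [:0, 0, 1:]) u) (rho N)"
proof -
  have Dd: "rho Dd = [:[:0, 0, 1:] :: 'k poly:]"
    by (simp add: Dd_def rhom.hom_simps[OF rhom_rho] power2_eq_square)
  have inner: "rho (poly (map_poly cst h) Dd) = [:pcompose h [:0, 0, 1:]:]" for h :: "'k poly"
  proof (induction h)
    case (pCons c h)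
    have "rho (poly (map_poly cst (pCons c h)) Dd) = rho (cst c) + rho Dd * rho (poly (map_poly cst h) Dd)"
      by (simp only: rhom.poly_map_poly_pCons[OF rhom_cst] rhom.add[OF rhom_rho] rhom.mult[OF rhom_rho])
    then show ?case
      unfolding pCons.IH Dd by (simp add: pcompose_pCons)
  qed (simp add: rhom.zero[OF rhom_rho])
  have "rho (poly (map_poly (\<lambda>h. poly (map_poly cst h) Dd) u) N)
      = pcompose (map_poly (\<lambda>h. pcompose h [:0, 0, 1:]) u) (rho N)"
  proof (induction u)
    case (pCons c h)
    have "rho (poly (map_poly (\<lambda>h. poly (map_poly cst h) Dd) (pCons c h)) N)
      = rho (poly (map_poly cst c) Dd) + rho N * rho (poly (map_poly (\<lambda>h. poly (map_poly cst h) Dd) h) N)"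
      by (simp only: rhom.poly_map_poly_pCons[OF rhom_eval1] rhom.add[OF rhom_rho] rhom.mult[OF rhom_rho])
    then show ?case
      unfolding pCons.IH inner by (simp add: pcompose_pCons map_poly_pCons)
  qed (simp add: rhom.zero[OF rhom_rho])
  then show ?thesis
    unfolding ev3_const_eq .
qed

text \<open>The norm contributes p to the x1-exponent with a constant leading coefficient, and d
  contributes 2 to the x2-exponent.\<close>

lemma lexdeg_rho_ev3_const:
  fixes u :: "'k::idom poly poly"
  assumes "u \<noteq> 0" "p > 0"
  shows "\<exists>q e. lexdeg (rho (ev3 [:u:] 0 (normX1 p) Dd)) (p * q) (2 * e)"
proof -
  let ?N = "rho (normX1 p) :: 'k poly poly" and ?x = "[:0, 0, 1:] :: 'k poly"
  let ?u = "map_poly (\<lambda>h. pcompose h ?x) u"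
  have inj: "pcompose h ?x \<noteq> 0" if "h \<noteq> 0" for h
    using that pcompose_eq_0[of h ?x] by auto
  have N: "?N \<noteq> 0" "degree ?N = p" "degree (lead_coeff ?N) = 0" "lead_coeff ?N \<noteq> 0"
    using lexdeg_rho_normX1[of p, where 'k='k] unfolding lexdeg_def leading_coeff_0_iff by simp_all
  have lu: "pcompose (lead_coeff u) ?x \<noteq> 0" using inj assms(1) by simp
  have du: "degree ?u = degree u"
    by (rule map_poly_degree_eq) (use lu in simp)
  have lcu: "lead_coeff ?u = pcompose (lead_coeff u) ?x"
    unfolding du by (simp add: coeff_map_poly)
  have "lead_coeff (pcompose ?u ?N) = lead_coeff ?u * lead_coeff ?N ^ degree ?u"
    using N assms(2) by (intro lead_coeff_comp) simp
  moreover have "degree (lead_coeff ?u * lead_coeff ?N ^ degree ?u) = 2 * degree (lead_coeff u)"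
  proof -
    have "degree (A * B ^ k) = degree A" if "A \<noteq> 0" "B \<noteq> 0" "degree B = 0" for A B :: "'k poly" and k
      using that by (simp add: degree_mult_eq degree_power_eq)
    then show ?thesis
      using N lu unfolding lcu by (simp add: degree_pcompose del: mult_eq_0_iff)
  qed
  ultimately have lc: "degree (lead_coeff (pcompose ?u ?N)) = 2 * degree (lead_coeff u)"
    by metis
  have "lexdeg (pcompose ?u ?N) (p * degree u) (2 * degree (lead_coeff u))"
  proof -
    have "?u \<noteq> 0" using lu lcu leading_coeff_0_iff by metis
    then have "pcompose ?u ?N \<noteq> 0"
      using pcompose_eq_0[of ?u ?N] N(2) assms(2) by auto
    moreover have "degree (pcompose ?u ?N) = p * degree u"
      using N(2) du by (simp add: degree_pcompose mult.commute)
    ultimately show ?thesis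
      unfolding lexdeg_def using lc by metis
  qed
  then show ?thesis
    unfolding rho_ev3_const by blast
qed

text \<open>This is A = k[d, N] + x3 A with N the norm: the outer variable of the parametrising
  polynomial stands for x3, and its constant term is split off.\<close>

lemma algA_split:
  assumes "a \<in> algA p"
  shows "\<exists>u a'. a' \<in> algA p \<and> a = ev3 [:u:] 0 (normX1 p) Dd + X3 * a'"
proof -
  obtain q where q: "a = ev3 q X3 Dd (normX1 p)"
    using assms by (auto simp: algA_Dd)
  obtain h t where ht: "q = pCons h t" by (cases q)
  let ?S = "range (\<lambda>u. ev3 [:u:] 0 (normX1 p) Dd)"
  have S: "rhom (\<lambda>u. ev3 [:u:] 0 (normX1 p) Dd)"
    by (rule rhom_comp[OF rhom_ev3 rhom_const])
  \<comment> \<open>The roles of d and the norm are exchanged, so that the norm is the outer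
    variable as \<open>lexdeg_rho_ev3_const\<close> expects.\<close>
  have "ev3 [:h:] 0 Dd (normX1 p) \<in> ?S"
  proof (rule ev3_in_subring)
    show "x + y \<in> ?S" "x * y \<in> ?S" if "x \<in> ?S" "y \<in> ?S" for x y
      using that by (auto simp flip: rhom.add[OF S] rhom.mult[OF S])
    show "cst c \<in> ?S" for c
      by (rule range_eqI[of _ _ "[:[:c:]:]"]) simp
    show "0 \<in> ?S"
      by (rule range_eqI[of _ _ 0]) (simp add: rhom.zero[OF rhom_ev3])
    show "Dd \<in> ?S"
      by (rule range_eqI[of _ _ "[:[:0, 1:]:]"]) (simp flip: X3_def)
    show "normX1 p \<in> ?S"
      by (rule range_eqI[of _ _ "[:0, 1:]"]) (simp flip: X2_def)
  qed
  then obtain u where u: "ev3 [:h:] 0 Dd (normX1 p) = ev3 [:u:] 0 (normX1 p) Dd" by blast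
  have "a = ev3 [:h:] 0 Dd (normX1 p) + X3 * ev3 t X3 Dd (normX1 p)"
    unfolding q ht ev3_pCons[of h t] ev3_const_eq ..
  then show ?thesis
    unfolding u algA_Dd by blast
qed

section \<open>Leading exponents of S_n modulo x3\<close>

text \<open>The leading exponents of \<^term>\<open>Sn p n j\<close> modulo \<open>x\<^sub>3\<close>, ordered lexicographically with \<open>x\<^sub>1\<close> first.\<close>

definition expo :: "nat \<Rightarrow> nat \<Rightarrow> nat \<Rightarrow> nat \<times> nat" where
  "expo p n j = (if j < n then (j div 2, j mod 2)
     else if even (j - n) then (n - 1 - (j - n) div 2, p - n + 1)
     else (n - (j - n + 1) div 2, p - n))"

lemma expo_less: "j < 2 * n \<Longrightarrow> fst (expo p n j) < n"
  by (auto simp: expo_def elim: oddE)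

text \<open>The first exponent and the parity of the second are packed into one number
  \<open>key\<close>, which is injective on the indices below 2n.\<close>

lemma expo_inj:
  assumes "odd p" "n \<le> p" "i < 2 * n" "j < 2 * n" "fst (expo p n i) = fst (expo p n j)"
    "snd (expo p n i) mod 2 = snd (expo p n j) mod 2"
  shows "i = j"
proof -
  \<comment> \<open>As p is odd, p - n and n have opposite parity.\<close>
  have par: "(p - n + 1) mod 2 = n mod 2" "(p - n) mod 2 = (n + 1) mod 2"
  proof -
    obtain d where d: "p = n + d" using assms(2) le_Suc_ex by blast
    show "(p - n + 1) mod 2 = n mod 2" "(p - n) mod 2 = (n + 1) mod 2"
      using assms(1) unfolding d by (simp_all add: mod2_eq_if)
  qed
  define key where "key j = 2 * fst (expo p n j) + snd (expo p n j) mod 2" for j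
  \<comment> \<open>The first half gives 0, ..., n - 1. The second gives n, ..., 2n - 1, in
    descending order for odd n and with neighbours swapped for even n.\<close>
  have key: "key j = (if j < n then j else if odd n then 3 * n - 1 - j
      else if even j then 3 * n - 2 - j else 3 * n - j)" if "j < 2 * n" for j
  proof (cases "j < n")
    case False
    then obtain i where i: "j = n + i" using le_Suc_ex[of n j] by auto
    then have "i < n" using that by simp
    then show ?thesis
      using False par unfolding key_def expo_def i
      by (cases "even i"; cases "even n") (simp_all, (auto elim!: evenE oddE)[4])
  qed (simp add: key_def expo_def)
  have "key i = key j" using assms(5,6) by (simp add: key_def)
  moreover have "3 * n - 2 - x \<noteq> 3 * n - y" if "even x" "odd y" "x < 2 * n" "y < 2 * n" for x y
  proof
    assume "3 * n - 2 - x = 3 * n - y"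
    then have "y = x + 2" using that(3,4) by linarith
    then show False using that(1,2) by simp
  qed
  \<comment> \<open>Keys of the second half stay at or above n; parity excludes the index 2n - 1,
    where this formula would fall short.\<close>
  moreover have "n \<le> 3 * n - 2 - x" if "even x" "x < 2 * n" for x
  proof -
    have "x \<noteq> 2 * n - 1" using that by auto
    then show ?thesis using that(2) by linarith
  qed
  ultimately show ?thesis
    unfolding key[OF assms(3)] key[OF assms(4)] using assms(3,4)
    by (simp split: if_splits) (metis not_less)+
qed

section \<open>Independence and saturation\<close>

context
  fixes p n :: nat and ty :: "'k::field itself"
  assumes p: "prime p" "odd p" "CHAR('k) = p" and n: "1 \<le> n" "n \<le> p"
begin

text \<open>In the second half \<open>Delta\<close> acts on x1^a, or on x1^a x2, with a < p, so it
  never meets an x1-exponent divisible by p. For even i > 0 the \<open>Delta\<close> inside P_i adds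
  one more step.\<close>

lemma lexdeg_rho_Sn:
  assumes "j < 2 * n"
  shows "lexdeg (rho (Sn p n j :: 'k mpoly3)) (fst (expo p n j)) (snd (expo p n j))"
proof (cases "j < n")
  case True
  have "(Mi j :: 'k mpoly3) = X1 ^ (j div 2) * X2 ^ (j mod 2)"
    by (cases "even j") (auto simp: Mi_def elim!: evenE oddE)
  then show ?thesis
    using True lexdeg_rho_monomial[of "j div 2" "j mod 2", where 'k='k]
    by (simp add: Sn_def expo_def)
next
  case False
  define i where "i = j - n"
  have i: "i < n" using False assms by (simp add: i_def)
  have nd: "\<not> CHAR('k) dvd l" if "0 < l" "l < p" for l
    using that p(3) by (auto dest: dvd_imp_le)
  have X1: "lexdeg (rho (X1 ^ a :: 'k mpoly3)) a 0" for a
    using lexdeg_rho_monomial[of a 0, where 'k='k] by simp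
  consider "i = 0" | "odd i" | "i > 0" "even i" by blast
  then have "lexdeg (rho ((Delta ^^ (p - n)) (Pi p i) :: 'k mpoly3)) (fst (expo p n j)) (snd (expo p n j))"
  proof cases
    case 1
    have "lexdeg (rho ((Delta ^^ (p - n)) (X1 ^ (p - 1) * X2) :: 'k mpoly3)) (p - 1 - (p - n)) (1 + (p - n))"
      using lexdeg_rho_monomial[of "p - 1" 1, where 'k='k]
      by (intro lexdeg_rho_Delta_funpow) (use n nd in auto)
    moreover have "p - 1 - (p - n) = n - 1" using n by simp
    moreover have "expo p n j = (n - 1, p - n + 1)"
      using False 1 by (simp add: expo_def flip: i_def)
    ultimately show ?thesis
      using 1 by (simp add: Pi_def)
  next
    case 2
    let ?a = "p - (i + 1) div 2"
    have ia: "1 \<le> (i + 1) div 2" "(i + 1) div 2 \<le> n"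
      using 2 i by (auto elim!: oddE)
    have "lexdeg (rho ((Delta ^^ (p - n)) (X1 ^ ?a) :: 'k mpoly3)) (?a - (p - n)) (0 + (p - n))"
      by (intro lexdeg_rho_Delta_funpow X1) (use n nd ia in auto)
    moreover have "?a - (p - n) = n - (i + 1) div 2" using n ia by simp
    moreover have "expo p n j = (n - (i + 1) div 2, p - n)"
      using False 2 by (simp add: expo_def flip: i_def)
    moreover have "(Pi p i :: 'k mpoly3) = X1 ^ ?a"
      using 2 odd_pos[of i] by (simp add: Pi_def)
    ultimately show ?thesis by simp
  next
    case 3
    let ?a = "p - i div 2"
    have ia: "1 \<le> i div 2" "i div 2 < n"
      using 3 i by (auto elim!: evenE)
    have "lexdeg (rho ((Delta ^^ Suc (p - n)) (X1 ^ ?a) :: 'k mpoly3)) (?a - Suc (p - n)) (0 + Suc (p - n))"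
      by (intro lexdeg_rho_Delta_funpow X1) (use n nd ia in auto)
    moreover have "?a - Suc (p - n) = n - 1 - i div 2" using n ia by simp
    moreover have "expo p n j = (n - 1 - i div 2, p - n + 1)"
      using False 3 by (simp add: expo_def flip: i_def)
    moreover have "(Delta ^^ (p - n)) (Pi p i) = (Delta ^^ Suc (p - n)) (X1 ^ ?a :: 'k mpoly3)"
      using 3 by (simp add: Pi_def funpow_swap1)
    ultimately show ?thesis by simp
  qed
  then show ?thesis
    using False by (simp add: Sn_def i_def)
qed

text \<open>Each coefficient is split by \<open>algA_split\<close>. The nonzero parts in k[d, N]
  would give summands with distinct leading exponents modulo x3, so there are none, and x3 divides
  every coefficient within A.\<close>

lemma Sn_independent_mod_X3:
  fixes a :: "nat \<Rightarrow> 'k mpoly3"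
  assumes "\<forall>j<2*n. a j \<in> algA p" "rho (\<Sum>j<2*n. a j * Sn p n j) = 0"
  shows "\<exists>b. (\<forall>j<2*n. b j \<in> algA p \<and> a j = X3 * b j)"
proof -
  have "\<forall>j. \<exists>u b. j < 2 * n \<longrightarrow> b \<in> algA p \<and> a j = ev3 [:u:] 0 (normX1 p) Dd + X3 * b"
    using algA_split assms(1) by blast
  then obtain u b where ub: "\<And>j. j < 2 * n \<Longrightarrow> b j \<in> algA p"
      "\<And>j. j < 2 * n \<Longrightarrow> a j = ev3 [:u j:] 0 (normX1 p) Dd + X3 * b j"
    unfolding choice_iff by blast
  let ?e = "\<lambda>j. rho (ev3 [:u j:] 0 (normX1 p) Dd)"
  define J where "J = {j. j < 2 * n \<and> u j \<noteq> 0}"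
  have pp: "p > 0" using n by simp
  have "\<forall>j. \<exists>q e. j \<in> J \<longrightarrow> lexdeg (?e j) (p * q) (2 * e)"
    using lexdeg_rho_ev3_const[OF _ pp] unfolding J_def by blast
  then obtain q e where qe: "\<And>j. j \<in> J \<Longrightarrow> lexdeg (?e j) (p * q j) (2 * e j)"
    unfolding choice_iff by blast
  have "rho (a j * Sn p n j) = ?e j * rho (Sn p n j)" if "j < 2 * n" for j
    using ub(2)[OF that] by (simp add: rhom.hom_simps[OF rhom_rho])
  then have "0 = (\<Sum>j<2*n. ?e j * rho (Sn p n j))"
    using assms(2) by (simp add: rhom.sum[OF rhom_rho])
  also have "\<dots> = (\<Sum>j\<in>J. ?e j * rho (Sn p n j))"
    by (rule sum.mono_neutral_right) (auto simp: J_def rhom.zero[OF rhom_ev3] rhom.zero[OF rhom_rho])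
  finally have zero: "(\<Sum>j\<in>J. ?e j * rho (Sn p n j)) = 0" by simp
  have lex: "lexdeg (?e j * rho (Sn p n j)) (p * q j + fst (expo p n j)) (2 * e j + snd (expo p n j))"
    if "j \<in> J" for j
    using that by (intro lexdeg_mult qe lexdeg_rho_Sn) (auto simp: J_def)
  have "inj_on (\<lambda>j. (p * q j + fst (expo p n j), 2 * e j + snd (expo p n j))) J"
  proof (rule inj_onI)
    fix i j
    assume ij: "i \<in> J" "j \<in> J"
      and eq: "(p * q i + fst (expo p n i), 2 * e i + snd (expo p n i))
        = (p * q j + fst (expo p n j), 2 * e j + snd (expo p n j))"
    have l: "i < 2 * n" "j < 2 * n" using ij by (auto simp: J_def)
    \<comment> \<open>Reducing modulo p and modulo 2 removes the contribution of A; the first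
      entries of \<open>expo\<close> are below n \<le> p and are recovered exactly.\<close>
    have "(p * q i + fst (expo p n i)) mod p = (p * q j + fst (expo p n j)) mod p"
      using eq by simp
    then have "fst (expo p n i) = fst (expo p n j)"
      using expo_less[OF l(1), of p] expo_less[OF l(2), of p] n by simp
    moreover have "(2 * e i + snd (expo p n i)) mod 2 = (2 * e j + snd (expo p n j)) mod 2"
      using eq by simp
    then have "snd (expo p n i) mod 2 = snd (expo p n j) mod 2"
      by simp
    ultimately show "i = j"
      using expo_inj[OF p(2) n(2) l] by blast
  qed
  moreover have "finite J" by (simp add: J_def)
  ultimately have "J = {}"
    using sum_lexdeg_nonzero[of J "\<lambda>j. ?e j * rho (Sn p n j)", OF _ _ lex] zero by blast
  then have "a j = X3 * b j" if "j < 2 * n" for j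
    using ub(2)[OF that] that by (simp add: J_def rhom.zero[OF rhom_ev3])
  then show ?thesis
    using ub(1) by blast
qed

text \<open>The relation vanishes modulo x3, so x3 divides all coefficients within A and can be
  cancelled.\<close>

lemma Ln_X3_saturated:
  fixes f :: "'k mpoly3"
  assumes "X3 * f \<in> Ln p n"
  shows "f \<in> Ln p n"
proof -
  obtain a where a: "\<forall>j<2*n. a j \<in> algA p" "X3 * f = (\<Sum>j<2*n. a j * Sn p n j)"
    using assms unfolding Ln_def by blast
  have "rho (\<Sum>j<2*n. a j * Sn p n j) = 0"
    unfolding a(2)[symmetric] by (simp add: rhom.mult[OF rhom_rho])
  then obtain b where b: "\<forall>j<2*n. b j \<in> algA p \<and> a j = X3 * b j"
    using Sn_independent_mod_X3[OF a(1)] by blast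
  then have "X3 * f = X3 * (\<Sum>j<2*n. b j * Sn p n j)"
    unfolding a(2) by (simp add: sum_distrib_left mult.assoc)
  moreover have "(X3 :: 'k mpoly3) \<noteq> 0" by (simp add: X3_def)
  ultimately have "f = (\<Sum>j<2*n. b j * Sn p n j)"
    by simp
  then show ?thesis
    using b unfolding Ln_def by blast
qed

lemma Ln_xunit_saturated:
  fixes f :: "'k mpoly3"
  assumes "xunit v" "[:v:] * f \<in> Ln p n"
  shows "f \<in> Ln p n"
proof -
  obtain u r where u: "u \<noteq> 0" "[:v:] = cst u * X3 ^ r"
    using xunit_cst_X3[OF assms(1)] by blast
  have inv: "cst (inverse u) * cst u = (1 :: 'k mpoly3)"
    using u(1) by (simp add: one_pCons)
  have "cst (inverse u) * ([:v:] * f) = (cst (inverse u) * cst u) * (X3 ^ r * f)"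
    unfolding u(2) by (simp only: mult.assoc)
  then have "cst (inverse u) * ([:v:] * f) = X3 ^ r * f"
    unfolding inv by simp
  moreover have "cst (inverse u) * ([:v:] * f) \<in> Ln p n"
    by (intro Ln_mult algA_cst assms(2))
  ultimately have "X3 ^ r * f \<in> Ln p n" by simp
  then show ?thesis
    by (induction r) (simp_all add: mult.assoc Ln_X3_saturated)
qed

section \<open>Kernel equals span, and uniqueness of coefficients\<close>

lemma Kn_eq_Ln: "(Kn n :: 'k mpoly3 set) = Ln p n"
proof
  show "(Kn n :: 'k mpoly3 set) \<subseteq> Ln p n"
    using xunit_mult_in_Ln[OF p n(2)] Ln_xunit_saturated by blast
  show "(Ln p n :: 'k mpoly3 set) \<subseteq> Kn n"
  proof
    fix f :: "'k mpoly3"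
    assume "f \<in> Ln p n"
    then obtain a where a: "\<forall>j<2*n. a j \<in> algA p" "f = (\<Sum>j<2*n. a j * Sn p n j)"
      unfolding Ln_def by blast
    have "(Delta ^^ n) (a j * Sn p n j) = 0" if "j < 2 * n" for j
    proof -
      have "sigma (a j) = a j"
        using sigma_algA[where 'k='k, unfolded p(3), OF p(1,2)] a(1) that by blast
      then show ?thesis
        using Delta_funpow_invariant_mult Sn_in_Kn[OF p n(2) that] by (metis mult_zero_right)
    qed
    then show "f \<in> Kn n"
      unfolding Kn_def a(2) by (simp add: Delta_funpow_sum)
  qed
qed

text \<open>Infinite descent: dividing a vanishing combination by x3 gives another one with
  coefficients in A, so every power of x3 divides each coefficient.\<close>

lemma Sn_independent:
  fixes a :: "nat \<Rightarrow> 'k mpoly3"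
  assumes "\<forall>j<2*n. a j \<in> algA p" "(\<Sum>j<2*n. a j * Sn p n j) = 0" "j < 2 * n"
  shows "a j = 0"
proof (rule ccontr)
  have dvd: "X3 ^ r dvd a j" for r
    using assms
  proof (induction r arbitrary: a)
    case (Suc r)
    obtain b where b: "\<forall>j<2*n. b j \<in> algA p \<and> a j = X3 * b j"
      using Sn_independent_mod_X3[OF Suc.prems(1)] Suc.prems(2) rhom.zero[OF rhom_rho] by metis
    have "X3 * (\<Sum>j<2*n. b j * Sn p n j) = 0"
      using b Suc.prems(2) by (simp add: sum_distrib_left mult.assoc)
    then have "(\<Sum>j<2*n. b j * Sn p n j) = 0"
      by (simp add: X3_def)
    then have "X3 ^ r dvd b j"
      using Suc.IH b Suc.prems(3) by blast
    then show ?case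
      using b Suc.prems(3) by (simp add: mult_dvd_mono)
  qed simp
  assume "a j \<noteq> 0"
  then obtain i l where c: "coeff (coeff (a j) i) l \<noteq> 0"
    by (metis leading_coeff_0_iff)
  let ?c = "coeff (coeff (a j) i) l"
  \<comment> \<open>\<open>?c\<close> is a nonzero polynomial in x3; a power of x3 beyond its degree
    cannot divide it.\<close>
  have "monom 1 (Suc (degree ?c)) dvd ?c"
    using dvd[of "Suc (degree ?c)"] unfolding X3_power const_poly_dvd_iff by blast
  then show False
    using dvd_imp_degree_le[OF _ c] by (force simp: degree_monom_eq)
qed

end

text \<open>Freeness is expressed by unique coefficient families. A family is a function on all
  naturals, so its values from 2n on are fixed to 0.\<close>

theorem theorem4p12:
  fixes p n :: nat
  assumes "prime p" and "odd p"
    and "CHAR('k::field) = p"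
    and "1 \<le> n" and "n \<le> p"
  shows "(\<forall>a. (\<forall>j<2*n. a j \<in> algA p) \<longrightarrow>
            (\<Sum>j<2*n. a j * Sn p n j) \<in> (Kn n :: 'k mpoly3 set))
       \<and> (\<forall>f \<in> (Kn n :: 'k mpoly3 set). \<exists>!a. (\<forall>j<2*n. a j \<in> algA p) \<and> (\<forall>j\<ge>2*n. a j = 0)
            \<and> f = (\<Sum>j<2*n. a j * Sn p n j))"
proof (intro conjI allI impI ballI)
  note Kn = Kn_eq_Ln[OF assms]
  show "(\<Sum>j<2*n. a j * Sn p n j) \<in> (Kn n :: 'k mpoly3 set)" if "\<forall>j<2*n. a j \<in> algA p" for a
    unfolding Kn Ln_def using that by blast
  fix f :: "'k mpoly3"
  assume "f \<in> Kn n"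
  then obtain a where a: "\<forall>j<2*n. a j \<in> algA p" "f = (\<Sum>j<2*n. a j * Sn p n j)"
    unfolding Kn Ln_def by blast
  show "\<exists>!a. (\<forall>j<2*n. a j \<in> algA p) \<and> (\<forall>j\<ge>2*n. a j = 0) \<and> f = (\<Sum>j<2*n. a j * Sn p n j)"
  proof (rule ex1I[of _ "\<lambda>j. if j < 2 * n then a j else 0"])
    show "(\<forall>j<2*n. (if j < 2 * n then a j else 0) \<in> algA p)
        \<and> (\<forall>j\<ge>2*n. (if j < 2 * n then a j else 0) = 0)
        \<and> f = (\<Sum>j<2*n. (if j < 2 * n then a j else 0) * Sn p n j)"
      using a by simp
  next
    fix b :: "nat \<Rightarrow> 'k mpoly3"
    assume b: "(\<forall>j<2*n. b j \<in> algA p) \<and> (\<forall>j\<ge>2*n. b j = 0) \<and> f = (\<Sum>j<2*n. b j * Sn p n j)"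
    have "(\<Sum>j<2*n. (b j - a j) * Sn p n j) = 0"
      using a(2) b by (simp add: left_diff_distrib sum_subtractf)
    then have "b j - a j = 0" if "j < 2 * n" for j
      using that a b by (intro Sn_independent[OF assms, of "\<lambda>j. b j - a j"]) (auto intro: algA_diff)
    then show "b = (\<lambda>j. if j < 2 * n then a j else 0)"
      using b by (intro ext) auto
  qed
qed

end
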